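(* Let $\mathbb{Z}[[\underline{x}]]=\mathbb{Z}[[x_1,\dots,x_n]]$, let $\mathfrak{m}=\langle x_1,\dots,x_n\rangle$, let $f\in\mathfrak{m}^2\subset\mathbb{Z}[[\underline{x}]]$, viewed also as an element of $\mathbb{C}[[\underline{x}]]$, and assume that $\mu(f)<\infty$. Then: (1) $\operatorname{lct}(f)\geq\frac{1}{\tau(f)}-\frac{1}{\mu(f)}$. (2) $\operatorname{lct}(f)\cdot\mu(f)+1\geq e^{\mathrm{BS}}(f)$.
   Context: All invariants are those of $f$ as an element of $\mathbb{C}[[\underline{x}]]$. The Jacobian ideal is $\operatorname{Jac}(f)=\langle\partial_1(f),\dots,\partial_n(f)\rangle\subset\mathbb{C}[[\underline{x}]]$ (formal partial derivatives), and the Milnor and Tjurina numbers are $\mu(f)=\dim_{\mathbb{C}}\big(\mathbb{C}[[\underline{x}]]/\operatorname{Jac}(f)\big)$ and $\tau(f)=\dim_{\mathbb{C}}\big(\mathbb{C}[[\underline{x}]]/(\operatorname{Jac}(f)+\langle f\rangle)\big)$. The log canonical threshold of a nonzero non-unit $f\in\mathbb{C}[[\underline{x}]]$ is $\operatorname{lct}(f)=\inf_E \frac{A(E)}{\operatorname{ord}_E(f)}$, where $E$ runs over divisorial valuations centered at the origin and $A(E)$ denotes the log discrepancy of $E$. For a non-unit $f\in\mathbb{C}[[\underline{x}]]$ with $f\in\sqrt{\operatorname{Jac}(f)}$ (which holds when $\mu(f)<\infty$), the Briançon–Skoda exponent $e^{\mathrm{BS}}(f)$ is the smallest integer $N\geq1$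 such that $f^N\in\operatorname{Jac}(f)$. *)

theory Defs
  imports
    Complex_Main
    "HOL-Library.Poly_Mapping"
    "HOL-Library.Extended_Real"
    "HOL-Computational_Algebra.Primes"
    "HOL-Computational_Algebra.Polynomial_Factorial"
    "Jordan_Normal_Form.Determinant"
begin

section \<open>Formal power series in finitely many variables\<close>

text \<open>
  The variables are indexed by a finite type \<open>'n\<close>, and a monomial is given by its exponent
  vector \<open>\<alpha> :: 'n \<Rightarrow>\<^sub>0 nat\<close>. Thus \<open>('a, 'n) mfps\<close> is \<open>'a[[x\<^sub>1, \<dots>, x\<^sub>n]]\<close> with
  \<open>n = CARD('n)\<close>.
\<close>

typedef ('a, 'n) mfps = "UNIV :: (('n \<Rightarrow>\<^sub>0 nat) \<Rightarrow> 'a) set"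
  morphisms mfps_coeff Abs_mfps ..

setup_lifting type_definition_mfps

lemma mfps_eqI: "(\<And>\<alpha>. mfps_coeff f \<alpha> = mfps_coeff g \<alpha>) \<Longrightarrow> f = g"
  by (metis mfps_coeff_inject ext)

lemma mfps_coeff_Abs [simp]: "mfps_coeff (Abs_mfps h) = h"
  by (simp add: Abs_mfps_inverse)

definition splits :: "('n \<Rightarrow>\<^sub>0 nat) \<Rightarrow> (('n \<Rightarrow>\<^sub>0 nat) \<times> ('n \<Rightarrow>\<^sub>0 nat)) set" where
  "splits \<alpha> = {(\<beta>, \<gamma>). \<beta> + \<gamma> = \<alpha>}"

lemma finite_splits [simp]: "finite (splits (\<alpha> :: 'n::finite \<Rightarrow>\<^sub>0 nat))"
proof -
  let ?B = "{h. \<forall>i. h i \<in> {.. Poly_Mapping.lookup \<alpha> i}}"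
  have fB: "finite ?B"
    by (rule finite_subset[OF _ finite_PiE[of UNIV "\<lambda>i. {.. Poly_Mapping.lookup \<alpha> i}"]]) (auto simp: PiE_def)
  have "finite (fst ` splits \<alpha>)"
  proof (rule finite_imageD)
    show "finite (Poly_Mapping.lookup ` fst ` splits \<alpha>)"
      by (rule finite_subset[OF _ fB]) (auto simp: splits_def lookup_add)
    show "inj_on Poly_Mapping.lookup (fst ` splits \<alpha>)"
      by (auto simp: inj_on_def lookup_inject)
  qed
  moreover have "inj_on fst (splits \<alpha>)"
    by (auto simp: inj_on_def splits_def)
  ultimately show ?thesis
    by (rule finite_imageD)
qed

instantiation mfps :: (comm_ring_1, finite) comm_ring_1
begin

definition zero_mfps :: "('a, 'b) mfps" where
  "0 = Abs_mfps (\<lambda>_. 0)"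

definition one_mfps :: "('a, 'b) mfps" where
  "1 = Abs_mfps (\<lambda>\<alpha>. if \<alpha> = 0 then 1 else 0)"

definition plus_mfps :: "('a, 'b) mfps \<Rightarrow> ('a, 'b) mfps \<Rightarrow> ('a, 'b) mfps" where
  "f + g = Abs_mfps (\<lambda>\<alpha>. mfps_coeff f \<alpha> + mfps_coeff g \<alpha>)"

definition uminus_mfps :: "('a, 'b) mfps \<Rightarrow> ('a, 'b) mfps" where
  "- f = Abs_mfps (\<lambda>\<alpha>. - mfps_coeff f \<alpha>)"

definition minus_mfps :: "('a, 'b) mfps \<Rightarrow> ('a, 'b) mfps \<Rightarrow> ('a, 'b) mfps" where
  "f - g = Abs_mfps (\<lambda>\<alpha>. mfps_coeff f \<alpha> - mfps_coeff g \<alpha>)"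

definition times_mfps :: "('a, 'b) mfps \<Rightarrow> ('a, 'b) mfps \<Rightarrow> ('a, 'b) mfps" where
  "f * g = Abs_mfps (\<lambda>\<alpha>. \<Sum>(\<beta>, \<gamma>)\<in>splits \<alpha>. mfps_coeff f \<beta> * mfps_coeff g \<gamma>)"

instance
proof
  fix f g h :: "('a, 'b) mfps"
  show "f * g * h = f * (g * h)"
  proof (rule mfps_eqI)
    fix \<alpha> :: "'b \<Rightarrow>\<^sub>0 nat"
    let ?F = "mfps_coeff f" and ?G = "mfps_coeff g" and ?H = "mfps_coeff h"
    have "mfps_coeff (f * g * h) \<alpha> =
        (\<Sum>p\<in>splits \<alpha>. \<Sum>q\<in>splits (fst p). ?F (fst q) * ?G (snd q) * ?H (snd p))"
      by (simp add: times_mfps_def sum_distrib_right case_prod_unfold)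
    also have "\<dots> = (\<Sum>(p, q)\<in>Sigma (splits \<alpha>) (\<lambda>p. splits (fst p)).
        ?F (fst q) * ?G (snd q) * ?H (snd p))"
      by (rule sum.Sigma) auto
    also have "\<dots> = (\<Sum>(p, q)\<in>Sigma (splits \<alpha>) (\<lambda>p. splits (snd p)).
        ?F (fst p) * (?G (fst q) * ?H (snd q)))"
      by (rule sum.reindex_bij_witness
            [where i = "\<lambda>(p, q). ((fst p + fst q, snd q), (fst p, fst q))"
               and j = "\<lambda>(p, q). ((fst q, snd q + snd p), (snd q, snd p))"])
         (clarsimp simp: splits_def add.assoc mult.assoc)+
    also have "\<dots> =
        (\<Sum>p\<in>splits \<alpha>. \<Sum>q\<in>splits (snd p). ?F (fst p) * (?G (fst q) * ?H (snd q)))"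
      by (rule sum.Sigma[symmetric]) auto
    also have "\<dots> = mfps_coeff (f * (g * h)) \<alpha>"
      by (simp add: times_mfps_def sum_distrib_left case_prod_unfold)
    finally show "mfps_coeff (f * g * h) \<alpha> = mfps_coeff (f * (g * h)) \<alpha>" .
  qed
  show "f * g = g * f"
  proof (rule mfps_eqI)
    fix \<alpha> :: "'b \<Rightarrow>\<^sub>0 nat"
    show "mfps_coeff (f * g) \<alpha> = mfps_coeff (g * f) \<alpha>"
      unfolding times_mfps_def mfps_coeff_Abs
      by (rule sum.reindex_bij_witness[where i = prod.swap and j = prod.swap])
         (auto simp: splits_def ac_simps)
  qed
  show "1 * f = f"
  proof (rule mfps_eqI)
    fix \<alpha> :: "'b \<Rightarrow>\<^sub>0 nat"
    have "mfps_coeff (1 * f) \<alpha> =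
        (\<Sum>(\<beta>, \<gamma>)\<in>splits \<alpha>. (if \<beta> = 0 then 1 else 0) * mfps_coeff f \<gamma>)"
      by (simp add: times_mfps_def one_mfps_def)
    also have "\<dots> = (\<Sum>(\<beta>, \<gamma>)\<in>{(0 :: 'b \<Rightarrow>\<^sub>0 nat, \<alpha>)}. (if \<beta> = 0 then 1 else 0) * mfps_coeff f \<gamma>)"
    proof (rule sum.mono_neutral_right)
      show "\<forall>p\<in>splits \<alpha> - {(0, \<alpha>)}.
          (case p of (\<beta>, \<gamma>) \<Rightarrow> (if \<beta> = 0 then 1 else 0) * mfps_coeff f \<gamma>) = 0"
        by (auto simp: splits_def split: if_splits)
      show "{(0, \<alpha>)} \<subseteq> splits \<alpha>"
        by (simp add: splits_def)
    qed simp
    finally show "mfps_coeff (1 * f) \<alpha> = mfps_coeff f \<alpha>"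
      by simp
  qed
  show "(f + g) * h = f * h + g * h"
    by (rule mfps_eqI)
       (simp add: times_mfps_def plus_mfps_def case_prod_unfold distrib_right sum.distrib)
  show "(0 :: ('a, 'b) mfps) \<noteq> 1"
  proof
    assume "(0 :: ('a, 'b) mfps) = 1"
    from arg_cong[OF this, of "\<lambda>h. mfps_coeff h 0"] show False
      by (simp add: zero_mfps_def one_mfps_def)
  qed
  show "f + g + h = f + (g + h)"
    by (simp add: plus_mfps_def add.assoc)
  show "f + g = g + f"
    by (simp add: plus_mfps_def add.commute)
  show "0 + f = f"
    by (rule mfps_eqI) (simp add: plus_mfps_def zero_mfps_def)
  show "- f + f = 0"
    by (simp add: plus_mfps_def uminus_mfps_def zero_mfps_def)
  show "f - g = f + - g"
    by (simp add: plus_mfps_def uminus_mfps_def minus_mfps_def)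
qed

end

lemma mfps_coeff_0 [simp]: "mfps_coeff 0 \<alpha> = 0"
  by (simp add: zero_mfps_def)

lemma mfps_coeff_times:
  "mfps_coeff (f * g) \<alpha> = (\<Sum>(\<beta>, \<gamma>)\<in>splits \<alpha>. mfps_coeff f \<beta> * mfps_coeff g \<gamma>)"
  by (simp add: times_mfps_def)

text \<open>
  An injective homomorphism from exponent vectors to \<open>(\<nat>, \<cdot>)\<close>: send the variables to distinct
  primes. It well-orders the monomials compatibly with multiplication.
\<close>

lemma monomial_order_exists:
  "\<exists>N :: ('n::finite \<Rightarrow>\<^sub>0 nat) \<Rightarrow> nat.
     inj N \<and> (\<forall>\<alpha>. N \<alpha> > 0) \<and> (\<forall>\<alpha> \<beta>. N (\<alpha> + \<beta>) = N \<alpha> * N \<beta>)"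
proof -
  obtain p :: "'n \<Rightarrow> nat" where p: "inj p" "\<And>i. prime (p i)"
  proof -
    obtain P where P: "P \<subseteq> {p::nat. prime p}" "finite P" "card P = card (UNIV :: 'n set)"
      using infinite_arbitrarily_large[OF primes_infinite, of "card (UNIV :: 'n set)"] by blast
    then obtain p :: "'n \<Rightarrow> nat" where "bij_betw p UNIV P"
      using finite_same_card_bij[of "UNIV :: 'n set" P] by fastforce
    then have "inj p" "range p = P"
      by (simp_all add: bij_betw_def)
    moreover have "prime (p i)" for i
      using \<open>range p = P\<close> P(1) by blast
    ultimately show ?thesis
      using that by blast
  qed
  define N where "N \<alpha> = (\<Prod>i\<in>UNIV. p i ^ Poly_Mapping.lookup \<alpha> i)" for \<alpha> :: "'n \<Rightarrow>\<^sub>0 nat"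
  have mult: "multiplicity (p j) (N \<alpha>) = Poly_Mapping.lookup \<alpha> j" for j \<alpha>
  proof -
    have "multiplicity (p j) (N \<alpha>) = (\<Sum>i\<in>UNIV. multiplicity (p j) (p i ^ Poly_Mapping.lookup \<alpha> i))"
      unfolding N_def
    proof (rule prime_elem_multiplicity_prod_distrib)
      show "prime_elem (p j)"
        using p(2) by (simp add: prime_imp_prime_elem)
      show "0 \<notin> (\<lambda>i. p i ^ Poly_Mapping.lookup \<alpha> i) ` UNIV"
      proof
        assume "0 \<in> (\<lambda>i. p i ^ Poly_Mapping.lookup \<alpha> i) ` UNIV"
        then obtain i where "p i = 0"
          by auto
        then show False
          using p(2)[of i] by simp
      qed
    qed simp
    also have "\<dots> = (\<Sum>i\<in>UNIV. if i = j then Poly_Mapping.lookup \<alpha> i else 0)"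
    proof (rule sum.cong)
      fix i
      show "multiplicity (p j) (p i ^ Poly_Mapping.lookup \<alpha> i) =
          (if i = j then Poly_Mapping.lookup \<alpha> i else 0)"
      proof (cases "i = j")
        case True
        have "\<not> is_unit (p j)" "p j \<noteq> 0"
          using p(2)[of j] by (auto simp: not_prime_unit)
        then show ?thesis
          using True by (simp add: multiplicity_same_power)
      next
        case False
        then have "p j \<noteq> p i"
          using p(1) by (auto simp: inj_eq)
        then show ?thesis
          using False multiplicity_distinct_prime_power[OF p(2) p(2)] by simp
      qed
    qed simp
    finally show ?thesis
      by simp
  qed
  have "inj N"
  proof (rule injI)
    fix \<alpha> \<beta> :: "'n \<Rightarrow>\<^sub>0 nat"
    assume eq: "N \<alpha> = N \<beta>"
    show "\<alpha> = \<beta>"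
    proof (rule poly_mapping_eqI)
      fix j
      show "Poly_Mapping.lookup \<alpha> j = Poly_Mapping.lookup \<beta> j"
        unfolding mult[symmetric] eq ..
    qed
  qed
  moreover have "N \<alpha> > 0" for \<alpha>
    unfolding N_def using p(2) by (intro prod_pos) (simp add: prime_gt_0_nat)
  moreover have "N (\<alpha> + \<beta>) = N \<alpha> * N \<beta>" for \<alpha> \<beta>
    by (simp add: N_def lookup_add power_add prod.distrib)
  ultimately show ?thesis
    by (intro exI[of _ N]) simp
qed

instance mfps :: (idom, finite) idom
proof
  fix f g :: "('a, 'b) mfps"
  assume "f \<noteq> 0" "g \<noteq> 0"
  obtain N :: "('b \<Rightarrow>\<^sub>0 nat) \<Rightarrow> nat"
    where N: "inj N" "\<And>\<alpha>. N \<alpha> > 0" "\<And>\<alpha> \<beta>. N (\<alpha> + \<beta>) = N \<alpha> * N \<beta>"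
    using monomial_order_exists by blast
  have least: "\<exists>\<alpha>. mfps_coeff h \<alpha> \<noteq> 0 \<and> (\<forall>\<beta>. mfps_coeff h \<beta> \<noteq> 0 \<longrightarrow> N \<alpha> \<le> N \<beta>)"
    if h: "h \<noteq> 0" for h :: "('a, 'b) mfps"
  proof -
    obtain \<alpha>0 where "mfps_coeff h \<alpha>0 \<noteq> 0"
      using h by (metis mfps_coeff_0 mfps_eqI)
    then show ?thesis
      using ex_has_least_nat[of "\<lambda>\<alpha>. mfps_coeff h \<alpha> \<noteq> 0" \<alpha>0 N] by blast
  qed
  obtain \<alpha> where \<alpha>: "mfps_coeff f \<alpha> \<noteq> 0" "\<And>\<gamma>. mfps_coeff f \<gamma> \<noteq> 0 \<Longrightarrow> N \<alpha> \<le> N \<gamma>"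
    using least[OF \<open>f \<noteq> 0\<close>] by blast
  obtain \<beta> where \<beta>: "mfps_coeff g \<beta> \<noteq> 0" "\<And>\<gamma>. mfps_coeff g \<gamma> \<noteq> 0 \<Longrightarrow> N \<beta> \<le> N \<gamma>"
    using least[OF \<open>g \<noteq> 0\<close>] by blast
  have *: "\<gamma> = \<alpha> \<and> \<delta> = \<beta>"
    if "\<gamma> + \<delta> = \<alpha> + \<beta>" "mfps_coeff f \<gamma> \<noteq> 0" "mfps_coeff g \<delta> \<noteq> 0" for \<gamma> \<delta>
  proof -
    have eq: "N \<gamma> * N \<delta> = N \<alpha> * N \<beta>"
      using that(1) N(3) by metis
    have le: "N \<alpha> \<le> N \<gamma>" "N \<beta> \<le> N \<delta>"
      using \<alpha>(2) \<beta>(2) that by auto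
    have "N \<gamma> = N \<alpha>"
    proof (rule ccontr)
      assume "N \<gamma> \<noteq> N \<alpha>"
      then have "N \<alpha> < N \<gamma>"
        using le by simp
      then have "N \<alpha> * N \<beta> < N \<gamma> * N \<delta>"
        using le N(2) by (intro mult_less_le_imp_less) auto
      then show False
        using eq by simp
    qed
    then have "\<gamma> = \<alpha>"
      using N(1) by (simp add: inj_eq)
    with that(1) show ?thesis
      by simp
  qed
  have "mfps_coeff (f * g) (\<alpha> + \<beta>) =
      (\<Sum>(\<gamma>, \<delta>)\<in>{(\<alpha>, \<beta>)}. mfps_coeff f \<gamma> * mfps_coeff g \<delta>)"
    unfolding mfps_coeff_times
  proof (rule sum.mono_neutral_right)
    show "{(\<alpha>, \<beta>)} \<subseteq> splits (\<alpha> + \<beta>)"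
      by (simp add: splits_def)
    show "\<forall>p\<in>splits (\<alpha> + \<beta>) - {(\<alpha>, \<beta>)}.
        (case p of (\<gamma>, \<delta>) \<Rightarrow> mfps_coeff f \<gamma> * mfps_coeff g \<delta>) = 0"
      using * by (fastforce simp: splits_def)
  qed simp
  with \<alpha> \<beta> have "mfps_coeff (f * g) (\<alpha> + \<beta>) \<noteq> 0"
    by simp
  then show "f * g \<noteq> 0"
    by (metis mfps_coeff_0)
qed

definition mfps_const :: "'a::zero \<Rightarrow> ('a, 'n) mfps" where
  "mfps_const c = Abs_mfps (\<lambda>\<alpha>. if \<alpha> = 0 then c else 0)"

definition mfps_X :: "'n \<Rightarrow> ('a::zero_neq_one, 'n) mfps" where
  "mfps_X i = Abs_mfps (\<lambda>\<alpha>. if \<alpha> = Poly_Mapping.single i 1 then 1 else 0)"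

definition mfps_deriv :: "'n \<Rightarrow> ('a::semiring_1, 'n) mfps \<Rightarrow> ('a, 'n) mfps" where
  "mfps_deriv i f =
     Abs_mfps (\<lambda>\<alpha>. of_nat (Poly_Mapping.lookup \<alpha> i + 1) * mfps_coeff f (\<alpha> + Poly_Mapping.single i 1))"

definition to_complex_mfps :: "(int, 'n) mfps \<Rightarrow> (complex, 'n) mfps" where
  "to_complex_mfps f = Abs_mfps (\<lambda>\<alpha>. of_int (mfps_coeff f \<alpha>))"


section \<open>Ideals, Milnor and Tjurina numbers and related invariants\<close>

definition ideal_of :: "'a::comm_ring_1 set \<Rightarrow> 'a set" where
  "ideal_of S = module.span (*) S"

definition ideal_prod :: "'a::comm_ring_1 set \<Rightarrow> 'a set \<Rightarrow> 'a set" where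
  "ideal_prod I J = ideal_of {a * b | a b. a \<in> I \<and> b \<in> J}"

definition var_ideal :: "('a::comm_ring_1, 'n::finite) mfps set" where
  "var_ideal = ideal_of (range mfps_X)"

definition Jac :: "(complex, 'n::finite) mfps \<Rightarrow> (complex, 'n) mfps set" where
  "Jac f = ideal_of (range (\<lambda>i. mfps_deriv i f))"

text \<open>
  The residue classes of the elements of \<open>B\<close> are pairwise distinct and form a
  \<open>\<complex>\<close>-basis of the quotient by \<open>I\<close>.
\<close>

definition quotient_basis ::
    "(complex, 'n::finite) mfps set \<Rightarrow> (complex, 'n) mfps set \<Rightarrow> bool" where
  "quotient_basis I B \<longleftrightarrow> finite B \<and>
     (\<forall>g. \<exists>!c :: (complex, 'n) mfps \<Rightarrow> complex.
        (\<forall>b. b \<notin> B \<longrightarrow> c b = 0) \<and> g - (\<Sum>b\<in>B. mfps_const (c b) * b) \<in> I)"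

definition quotient_dim :: "(complex, 'n::finite) mfps set \<Rightarrow> enat" where
  "quotient_dim I =
     (if \<exists>B. quotient_basis I B then enat (card (SOME B. quotient_basis I B)) else \<infinity>)"

definition milnor :: "(complex, 'n::finite) mfps \<Rightarrow> enat" where
  "milnor f = quotient_dim (Jac f)"

definition tjurina :: "(complex, 'n::finite) mfps \<Rightarrow> enat" where
  "tjurina f = quotient_dim (ideal_of (Jac f \<union> {f}))"

definition bs_exponent :: "(complex, 'n::finite) mfps \<Rightarrow> nat" where
  "bs_exponent f = (LEAST N. N \<ge> 1 \<and> f ^ N \<in> Jac f)"


section \<open>Polynomials over a subring of a field\<close>

text \<open>
  \<open>(nat \<Rightarrow>\<^sub>0 nat) \<Rightarrow>\<^sub>0 'a\<close> is the polynomial ring over \<open>'a\<close> in the variables \<open>T\<^sub>0, T\<^sub>1, \<dots>\<close>;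
  \<open>polys m\<close> are those in which only \<open>T\<^sub>0, \<dots>, T\<^bsub>m-1\<^esub>\<close> occur.
\<close>

definition polys :: "nat \<Rightarrow> ((nat \<Rightarrow>\<^sub>0 nat) \<Rightarrow>\<^sub>0 'a::zero) set" where
  "polys m = {P. \<forall>\<alpha>\<in>Poly_Mapping.keys P. Poly_Mapping.keys \<alpha> \<subseteq> {..<m}}"

definition poly_eval :: "'a::idom fract list \<Rightarrow> ((nat \<Rightarrow>\<^sub>0 nat) \<Rightarrow>\<^sub>0 'a) \<Rightarrow> 'a fract" where
  "poly_eval ys P = (\<Sum>\<alpha>\<in>Poly_Mapping.keys P. to_fract (Poly_Mapping.lookup P \<alpha>) * (\<Prod>i\<in>Poly_Mapping.keys \<alpha>. (ys ! i) ^ Poly_Mapping.lookup \<alpha> i))"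

definition poly_deriv ::
    "nat \<Rightarrow> ((nat \<Rightarrow>\<^sub>0 nat) \<Rightarrow>\<^sub>0 'a::comm_ring_1) \<Rightarrow> ((nat \<Rightarrow>\<^sub>0 nat) \<Rightarrow>\<^sub>0 'a)" where
  "poly_deriv j P = (\<Sum>\<alpha>\<in>Poly_Mapping.keys P. Poly_Mapping.single (\<alpha> - Poly_Mapping.single j 1)
                                    (of_nat (Poly_Mapping.lookup \<alpha> j) * Poly_Mapping.lookup P \<alpha>))"

definition adjoin :: "'a::idom fract list \<Rightarrow> 'a fract set" where
  "adjoin ys = poly_eval ys ` polys (length ys)"


section \<open>Divisorial valuations, log discrepancy, log canonical threshold\<close>

text \<open>
  A normalized discrete valuation of a field. Its value at \<open>0\<close>, mathematically \<open>\<infinity>\<close>, is left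
  unspecified and never used.
\<close>

definition discrete_valuation :: "('k::field \<Rightarrow> int) \<Rightarrow> bool" where
  "discrete_valuation v \<longleftrightarrow>
     (\<forall>a b. a \<noteq> 0 \<longrightarrow> b \<noteq> 0 \<longrightarrow> v (a * b) = v a + v b) \<and>
     (\<forall>a b. a \<noteq> 0 \<longrightarrow> b \<noteq> 0 \<longrightarrow> a + b \<noteq> 0 \<longrightarrow> min (v a) (v b) \<le> v (a + b)) \<and>
     (\<exists>t. t \<noteq> 0 \<and> v t = 1)"

definition valuation_ring :: "('k::field \<Rightarrow> int) \<Rightarrow> 'k set" where
  "valuation_ring v = {z. z = 0 \<or> v z \<ge> 0}"

text \<open>
  Let \<open>R = \<complex>[[x\<^sub>1, \<dots>, x\<^sub>n]]\<close>. Prime divisors on models of \<open>Spec R\<close> are represented by charts: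
  \<open>y\<^sub>1, \<dots>, y\<^sub>m\<close> in \<open>Frac R\<close> are the coordinates of an affine scheme \<open>Spec R[y\<^sub>1, \<dots>, y\<^sub>m]\<close> of finite
  type and birational over \<open>Spec R\<close>, and the valuation ring of \<open>v\<close> is the local ring of this
  scheme at the prime \<open>{a. v a > 0}\<close>. That prime is the generic point of a prime divisor \<open>E\<close> in
  the normal locus, and \<open>v = ord\<^sub>E\<close>. Conversely, every prime divisor on a normal scheme that is
  proper (or just of finite type) and birational over \<open>Spec R\<close> has such a chart.
\<close>

definition divisor_chart ::
    "((complex, 'n::finite) mfps fract \<Rightarrow> int) \<Rightarrow> (complex, 'n) mfps fract list \<Rightarrow> bool" where
  "divisor_chart v ys \<longleftrightarrow>
     valuation_ring v = {a / b | a b. a \<in> adjoin ys \<and> b \<in> adjoin ys \<and> b \<noteq> 0 \<and> v b = 0}"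

text \<open>The last clause: the image of \<open>E\<close> in \<open>Spec R\<close>, i.e. the center of \<open>v\<close>, is the closed point.\<close>

definition divisorial_at_origin :: "((complex, 'n::finite) mfps fract \<Rightarrow> int) \<Rightarrow> bool" where
  "divisorial_at_origin v \<longleftrightarrow>
     discrete_valuation v \<and>
     (\<exists>ys. divisor_chart v ys) \<and>
     {r. r = 0 \<or> v (to_fract r) > 0} = var_ideal"

text \<open>
  The log discrepancy is \<open>A(E) = 1 + ord\<^sub>E(K\<^bsub>Y/X\<^esub>)\<close> with \<open>X = Spec R\<close>, where the relative
  canonical divisor \<open>K\<^bsub>Y/X\<^esub>\<close> of a regular model \<open>Y\<close> is the effective divisor defined by the
  Jacobian ideal \<open>Fitt\<^sub>0(\<Omega>\<^bsub>Y/X\<^esub>)\<close>. On a chart \<open>R[y\<^sub>1, \<dots>, y\<^sub>m] = R[T\<^sub>1, \<dots>, T\<^sub>m]/I\<close> the module of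
  differentials is generated by \<open>dT\<^sub>1, \<dots>, dT\<^sub>m\<close> with the relations \<open>dP = 0\<close> for \<open>P \<in> I\<close>, so this
  ideal is generated by the minors \<open>det (\<partial>P\<^sub>i/\<partial>T\<^sub>j)(y)\<close> with \<open>P\<^sub>1, \<dots>, P\<^sub>m \<in> I\<close>, and its order along
  \<open>E\<close> is the least value of \<open>v\<close> on the nonzero minors. Since Fitting ideals do not depend on the
  presentation and commute with localization, the result does not depend on the chart.
\<close>

definition chart_relations :: "'a::idom fract list \<Rightarrow> ((nat \<Rightarrow>\<^sub>0 nat) \<Rightarrow>\<^sub>0 'a) set" where
  "chart_relations ys = {P \<in> polys (length ys). poly_eval ys P = 0}"

definition jacobian_minors :: "'a::idom fract list \<Rightarrow> 'a fract set" where
  "jacobian_minors ys =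
     {det (mat (length ys) (length ys) (\<lambda>(i, j). poly_eval ys (poly_deriv j (P i)))) | P.
        \<forall>i < length ys. P i \<in> chart_relations ys}"

definition ord_relative_canonical ::
    "((complex, 'n::finite) mfps fract \<Rightarrow> int) \<Rightarrow> (complex, 'n) mfps fract list \<Rightarrow> nat" where
  "ord_relative_canonical v ys = (LEAST d. \<exists>D\<in>jacobian_minors ys. D \<noteq> 0 \<and> v D = int d)"

definition log_discrepancy :: "((complex, 'n::finite) mfps fract \<Rightarrow> int) \<Rightarrow> nat" where
  "log_discrepancy v = 1 + ord_relative_canonical v (SOME ys. divisor_chart v ys)"

text \<open>
  The log canonical threshold of a nonzero non-unit \<open>f\<close>; then all the values \<open>v f\<close> are finite
  and positive.
\<close>

definition lct :: "(complex, 'n::finite) mfps \<Rightarrow> ereal" where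
  "lct f = (INF v\<in>{v. divisorial_at_origin v}.
              ereal (real (log_discrepancy v) / real_of_int (v (to_fract f))))"

end

theory Submission
  imports Defs
begin

text \<open>
  Write \<open>R\<close> for the power series ring, \<open>e\<close> for the Briancon-Skoda exponent of \<open>f\<close> and \<open>d\<close>
  for its order at the origin. The key bound is \<open>lct f \<ge> 1 / d\<close>.

  Let \<open>v\<close> be divisorial with a chart \<open>R[y\<^sub>1, \<dots>, y\<^sub>m]\<close> and let \<open>M\<close> be a Jacobian minor with
  \<open>v M = A - 1\<close>, where \<open>A\<close> is the log discrepancy. By Cramer's rule \<open>M \<partial>\<^sub>i\<close> maps the chart, hence
  the valuation ring, to itself, and a derivation of a discrete valuation ring lowers the valuation
  by at most one. So \<open>v (\<partial>\<^sub>i g) \<ge> v g - A\<close>. Some derivative of \<open>f\<close> of order \<open>d\<close> is a unit, which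
  gives \<open>v f \<le> d A\<close>.

  On the other side, the powers of the maximal ideal strictly decrease in \<open>R / Jac f\<close> until they
  vanish, so all series of order at least \<open>\<mu>\<close> lie in \<open>Jac f\<close>. As \<open>f\<^bsup>e - 1\<^esup>\<close> does not, and has
  order \<open>d (e - 1)\<close>, we get \<open>d (e - 1) < \<mu>\<close> and the second inequality. The first one follows,
  because the filtration of \<open>R / Jac f\<close> by powers of \<open>f\<close> has \<open>e\<close> steps of dimension at most \<open>\<tau>\<close>,
  i.e. \<open>\<mu> \<le> e \<tau>\<close>.
\<close>

section \<open>Formal power series\<close>

lemma mfps_coeff_add [simp]: "mfps_coeff (f + g) \<alpha> = mfps_coeff f \<alpha> + mfps_coeff g \<alpha>"
  by (simp add: plus_mfps_def)

lemma mfps_coeff_diff [simp]: "mfps_coeff (f - g) \<alpha> = mfps_coeff f \<alpha> - mfps_coeff g \<alpha>"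
  by (simp add: minus_mfps_def)

lemma mfps_coeff_sum [simp]: "mfps_coeff (sum g A) \<alpha> = (\<Sum>a\<in>A. mfps_coeff (g a) \<alpha>)"
  by (induction A rule: infinite_finite_induct) simp_all

lemma mfps_coeff_1: "mfps_coeff 1 \<alpha> = (if \<alpha> = 0 then 1 else 0)"
  by (simp add: one_mfps_def)

lemma mfps_coeff_const: "mfps_coeff (mfps_const c) \<alpha> = (if \<alpha> = 0 then c else 0)"
  by (simp add: mfps_const_def)

lemma mfps_coeff_X: "mfps_coeff (mfps_X i) \<alpha> = (if \<alpha> = Poly_Mapping.single i 1 then 1 else 0)"
  by (simp add: mfps_X_def)

lemma mfps_coeff_deriv:
  "mfps_coeff (mfps_deriv i f) \<alpha> =
     of_nat (Poly_Mapping.lookup \<alpha> i + 1) * mfps_coeff f (\<alpha> + Poly_Mapping.single i 1)"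
  by (simp add: mfps_deriv_def)

lemma minus_single_add_single:
  fixes \<alpha> :: "'n \<Rightarrow>\<^sub>0 nat"
  assumes "Poly_Mapping.lookup \<alpha> i > 0"
  shows "\<alpha> - Poly_Mapping.single i 1 + Poly_Mapping.single i 1 = \<alpha>"
  using assms
  by (intro poly_mapping_eqI) (auto simp: lookup_add lookup_minus lookup_single when_def)

lemma mfps_coeff_const_mult [simp]:
  fixes h :: "('a::comm_ring_1, 'n::finite) mfps"
  shows "mfps_coeff (mfps_const c * h) \<alpha> = c * mfps_coeff h \<alpha>"
proof -
  have "mfps_coeff (mfps_const c * h) \<alpha> =
      (\<Sum>(\<beta>, \<gamma>)\<in>{(0 :: 'n \<Rightarrow>\<^sub>0 nat, \<alpha>)}. mfps_coeff (mfps_const c) \<beta> * mfps_coeff h \<gamma>)"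
    unfolding mfps_coeff_times
    by (intro sum.mono_neutral_right finite_splits) (auto simp: splits_def mfps_coeff_const split: if_splits)
  then show ?thesis
    by (simp add: mfps_coeff_const)
qed

lemma mfps_coeff_X_mult:
  fixes h :: "('a::comm_ring_1, 'n::finite) mfps"
  shows "mfps_coeff (mfps_X i * h) \<alpha> =
    (if Poly_Mapping.lookup \<alpha> i > 0 then mfps_coeff h (\<alpha> - Poly_Mapping.single i 1) else 0)"
proof (cases "Poly_Mapping.lookup \<alpha> i > 0")
  case True
  let ?e = "Poly_Mapping.single i 1 :: 'n \<Rightarrow>\<^sub>0 nat"
  have "\<alpha> = ?e + (\<alpha> - ?e)"
    using minus_single_add_single[OF True] by (simp add: add.commute)
  moreover have "\<gamma> = \<alpha> - ?e" if "?e + \<gamma> = \<alpha>" for \<gamma>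
    using that by (metis add_diff_cancel_left')
  ultimately have "mfps_coeff (mfps_X i * h) \<alpha> =
      (\<Sum>(\<beta>, \<gamma>)\<in>{(?e, \<alpha> - ?e)}. mfps_coeff (mfps_X i) \<beta> * mfps_coeff h \<gamma>)"
    unfolding mfps_coeff_times
    by (intro sum.mono_neutral_right finite_splits) (auto simp: splits_def mfps_coeff_X split: if_splits)
  then show ?thesis
    using True by (simp add: mfps_coeff_X)
next
  case False
  have "\<beta> \<noteq> Poly_Mapping.single i 1" if "\<beta> + \<gamma> = \<alpha>" for \<beta> \<gamma>
    using False that by (auto simp: lookup_add)
  then have "mfps_coeff (mfps_X i * h) \<alpha> = 0"
    unfolding mfps_coeff_times
    by (intro sum.neutral) (auto simp: splits_def mfps_coeff_X)
  then show ?thesis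
    using False by simp
qed

lemma mfps_deriv_add:
  "mfps_deriv i (f + g) = mfps_deriv i f + mfps_deriv i g"
  by (rule mfps_eqI) (simp add: mfps_coeff_deriv algebra_simps)

text \<open>The exponent of the differentiated variable is additive over every splitting of
  \<open>\<alpha> + ?e\<close>, so the convolution sum separates into two weighted sums, one for
  each factor carrying the derivative.\<close>

lemma mfps_deriv_mult:
  fixes f g :: "('a::comm_ring_1, 'n::finite) mfps"
  shows "mfps_deriv i (f * g) = mfps_deriv i f * g + f * mfps_deriv i g"
proof (rule mfps_eqI)
  fix \<alpha> :: "'n \<Rightarrow>\<^sub>0 nat"
  let ?l = "\<lambda>\<beta>. Poly_Mapping.lookup \<beta> i" and ?e = "Poly_Mapping.single i 1 :: 'n \<Rightarrow>\<^sub>0 nat"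
  let ?F = "mfps_coeff f" and ?G = "mfps_coeff g"
  \<comment> \<open>Splittings with \<open>?l \<beta> = 0\<close> contribute nothing. The others
    come from splittings of \<open>\<alpha>\<close> by adding \<open>?e\<close> to the first part,
    and the weight \<open>?l \<beta>\<close> becomes the factor in the coefficient of the
    derivative.\<close>
  have shift: "(\<Sum>(\<beta>, \<gamma>)\<in>splits (\<alpha> + ?e). of_nat (?l \<beta>) * mfps_coeff p \<beta> * mfps_coeff q \<gamma>) =
      mfps_coeff (mfps_deriv i p * q) \<alpha>" for p q :: "('a, 'n) mfps"
  proof -
    let ?A = "{x \<in> splits (\<alpha> + ?e). ?l (fst x) > 0}"
    have split_eq: "\<beta> - ?e + \<gamma> = \<alpha>" if "?l \<beta> > 0" "\<beta> + \<gamma> = \<alpha> + ?e" for \<beta> \<gamma>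
    proof -
      have "\<beta> - ?e + \<gamma> + ?e = \<alpha> + ?e"
        using minus_single_add_single[OF that(1)] that(2) by (metis add.assoc add.commute)
      then show ?thesis
        by simp
    qed
    have "(\<Sum>(\<beta>, \<gamma>)\<in>splits (\<alpha> + ?e). of_nat (?l \<beta>) * mfps_coeff p \<beta> * mfps_coeff q \<gamma>) =
        (\<Sum>(\<beta>, \<gamma>)\<in>?A. of_nat (?l \<beta>) * mfps_coeff p \<beta> * mfps_coeff q \<gamma>)"
      by (rule sum.mono_neutral_right) (auto, metis gr0I mult_zero_left of_nat_0)
    also have "\<dots> = (\<Sum>(\<beta>, \<gamma>)\<in>splits \<alpha>. mfps_coeff (mfps_deriv i p) \<beta> * mfps_coeff q \<gamma>)"
    proof (rule sum.reindex_bij_witness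
        [where i = "\<lambda>(\<beta>, \<gamma>). (\<beta> + ?e, \<gamma>)" and j = "\<lambda>(\<beta>, \<gamma>). (\<beta> - ?e, \<gamma>)"], goal_cases)
      case (1 x)
      then show ?case
        using minus_single_add_single[of "fst x" i] by (cases x) auto
    next
      case (2 x)
      then show ?case
        using split_eq by (cases x) (auto simp: splits_def)
    next
      case (3 x)
      then show ?case
        by (cases x) auto
    next
      case (4 x)
      then show ?case
        by (cases x) (auto simp: splits_def lookup_add ac_simps)
    next
      case (5 x)
      then show ?case
        using minus_single_add_single[of "fst x" i]
        by (cases x) (auto simp: mfps_coeff_deriv lookup_minus simp flip: of_nat_Suc)
    qed
    finally show ?thesis
      by (simp add: mfps_coeff_times)
  qed
  have "mfps_coeff (mfps_deriv i (f * g)) \<alpha> =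
      (\<Sum>(\<beta>, \<gamma>)\<in>splits (\<alpha> + ?e). of_nat (?l (\<alpha> + ?e)) * (?F \<beta> * ?G \<gamma>))"
    by (simp add: mfps_coeff_deriv mfps_coeff_times sum_distrib_left case_prod_unfold lookup_add)
  also have "\<dots> = (\<Sum>(\<beta>, \<gamma>)\<in>splits (\<alpha> + ?e). of_nat (?l \<beta>) * ?F \<beta> * ?G \<gamma>) +
      (\<Sum>(\<beta>, \<gamma>)\<in>splits (\<alpha> + ?e). of_nat (?l \<gamma>) * ?G \<gamma> * ?F \<beta>)"
    unfolding sum.distrib[symmetric]
  proof (rule sum.cong[OF refl], clarify)
    fix \<beta> \<gamma>
    assume "(\<beta>, \<gamma>) \<in> splits (\<alpha> + ?e)"
    then have "?l (\<alpha> + ?e) = ?l \<beta> + ?l \<gamma>"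
      unfolding splits_def using lookup_add[of \<beta> \<gamma> i] by auto
    then show "of_nat (?l (\<alpha> + ?e)) * (?F \<beta> * ?G \<gamma>) =
        of_nat (?l \<beta>) * ?F \<beta> * ?G \<gamma> + of_nat (?l \<gamma>) * ?G \<gamma> * ?F \<beta>"
      by (simp add: algebra_simps)
  qed
  also have "(\<Sum>(\<beta>, \<gamma>)\<in>splits (\<alpha> + ?e). of_nat (?l \<gamma>) * ?G \<gamma> * ?F \<beta>) =
      (\<Sum>(\<gamma>, \<beta>)\<in>splits (\<alpha> + ?e). of_nat (?l \<gamma>) * ?G \<gamma> * ?F \<beta>)"
    by (rule sum.reindex_bij_witness[where i = prod.swap and j = prod.swap])
      (auto simp: splits_def add.commute)
  also have "(\<Sum>(\<beta>, \<gamma>)\<in>splits (\<alpha> + ?e). of_nat (?l \<beta>) * ?F \<beta> * ?G \<gamma>) + \<dots> =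
      mfps_coeff (mfps_deriv i f * g + f * mfps_deriv i g) \<alpha>"
    unfolding shift by (simp add: mult.commute)
  finally show "mfps_coeff (mfps_deriv i (f * g)) \<alpha> =
      mfps_coeff (mfps_deriv i f * g + f * mfps_deriv i g) \<alpha>" .
qed

section \<open>The filtration by total degree\<close>

definition total_degree :: "('n::finite \<Rightarrow>\<^sub>0 nat) \<Rightarrow> nat" where
  "total_degree \<alpha> = (\<Sum>i\<in>UNIV. Poly_Mapping.lookup \<alpha> i)"

lemma total_degree_add: "total_degree (\<alpha> + \<beta>) = total_degree \<alpha> + total_degree \<beta>"
  by (simp add: total_degree_def lookup_add sum.distrib)

lemma total_degree_single [simp]: "total_degree (Poly_Mapping.single i k) = k"
  by (simp add: total_degree_def lookup_single when_def)

lemma total_degree_eq_0_iff [simp]: "total_degree \<alpha> = 0 \<longleftrightarrow> \<alpha> = 0"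
  by (auto simp: total_degree_def intro: poly_mapping_eqI)

lemma total_degree_0 [simp]: "total_degree 0 = 0"
  by simp

lemma total_degree_minus_single:
  assumes "Poly_Mapping.lookup \<alpha> i > 0"
  shows "total_degree \<alpha> = Suc (total_degree (\<alpha> - Poly_Mapping.single i 1))"
  using total_degree_add[of "\<alpha> - Poly_Mapping.single i 1" "Poly_Mapping.single i 1"]
  unfolding minus_single_add_single[OF assms] by simp

text \<open>The \<open>k\<close>-th power of the maximal ideal (of the ideal of the variables, over
  a general ring), encoded by vanishing coefficients so that infinite series can be tested
  directly.\<close>

definition order_ge :: "nat \<Rightarrow> ('a::comm_ring_1, 'n::finite) mfps set" where
  "order_ge k = {h. \<forall>\<alpha>. total_degree \<alpha> < k \<longrightarrow> mfps_coeff h \<alpha> = 0}"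

lemma order_geD: "h \<in> order_ge k \<Longrightarrow> total_degree \<alpha> < k \<Longrightarrow> mfps_coeff h \<alpha> = 0"
  by (simp add: order_ge_def)

lemma order_ge_add: "g \<in> order_ge k \<Longrightarrow> h \<in> order_ge k \<Longrightarrow> g + h \<in> order_ge k"
  by (simp add: order_ge_def)

lemma order_ge_0 [simp]: "h \<in> order_ge 0"
  by (simp add: order_ge_def)

lemma zero_in_order_ge [simp]: "0 \<in> order_ge k"
  by (simp add: order_ge_def)

lemma order_ge_mult:
  assumes "g \<in> order_ge k" and "h \<in> order_ge l"
  shows "g * h \<in> order_ge (k + l)"
  unfolding order_ge_def mem_Collect_eq
proof (intro allI impI)
  fix \<alpha> :: "'b \<Rightarrow>\<^sub>0 nat"
  assume "total_degree \<alpha> < k + l"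
  then have "mfps_coeff g \<beta> * mfps_coeff h \<gamma> = 0" if "\<beta> + \<gamma> = \<alpha>" for \<beta> \<gamma>
    using that total_degree_add[of \<beta> \<gamma>] order_geD[OF assms(1), of \<beta>] order_geD[OF assms(2), of \<gamma>]
    by (cases "total_degree \<beta> < k") auto
  then show "mfps_coeff (g * h) \<alpha> = 0"
    unfolding mfps_coeff_times by (intro sum.neutral) (auto simp: splits_def)
qed

lemma order_ge_power:
  assumes "h \<in> order_ge k"
  shows "h ^ m \<in> order_ge (m * k)"
  by (induction m) (auto intro: order_ge_mult assms)

lemma order_ge_deriv:
  assumes "h \<in> order_ge (Suc k)"
  shows "mfps_deriv i h \<in> order_ge k"
  using assms by (auto simp: order_ge_def mfps_coeff_deriv total_degree_add)

lemma X_in_order_ge: "mfps_X i \<in> order_ge (Suc 0)"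
proof -
  have "Poly_Mapping.single i (Suc 0) \<noteq> 0"
    by (metis lookup_single_eq lookup_zero Zero_not_Suc)
  then show ?thesis
    by (auto simp: order_ge_def mfps_coeff_X)
qed

text \<open>Every monomial of positive degree is assigned to one variable dividing it;
  \<open>g i\<close> collects the terms assigned to \<open>i\<close>, divided by that
  variable.\<close>

lemma order_ge_Suc_decompose:
  fixes h :: "('a::comm_ring_1, 'n::finite) mfps"
  assumes "h \<in> order_ge (Suc k)"
  obtains g where "\<And>i. g i \<in> order_ge k" "h = (\<Sum>i\<in>UNIV. mfps_X i * g i)"
proof -
  let ?e = "\<lambda>i. Poly_Mapping.single i 1 :: 'n \<Rightarrow>\<^sub>0 nat"
  \<comment> \<open>The choice is arbitrary at \<open>\<alpha> = 0\<close>, which is harmless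
    because \<open>h\<close> has no constant term.\<close>
  define s :: "('n \<Rightarrow>\<^sub>0 nat) \<Rightarrow> 'n" where "s \<alpha> = (SOME i. Poly_Mapping.lookup \<alpha> i > 0)" for \<alpha>
  have s: "Poly_Mapping.lookup \<alpha> (s \<alpha>) > 0" if "\<alpha> \<noteq> 0" for \<alpha>
  proof -
    have "\<exists>i. Poly_Mapping.lookup \<alpha> i > 0"
      using that poly_mapping_eqI[of \<alpha> 0] by (metis gr0I lookup_zero)
    then show ?thesis
      unfolding s_def by (rule someI_ex)
  qed
  define g where "g i = Abs_mfps (\<lambda>\<beta>. if s (\<beta> + ?e i) = i then mfps_coeff h (\<beta> + ?e i) else 0)" for i
  have "h = (\<Sum>i\<in>UNIV. mfps_X i * g i)"
  proof (rule mfps_eqI)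
    fix \<alpha>
    have "mfps_coeff (mfps_X i * g i) \<alpha> = (if i = s \<alpha> then mfps_coeff h \<alpha> else 0)" for i
    proof (cases "Poly_Mapping.lookup \<alpha> i > 0")
      case True
      then show ?thesis
        using minus_single_add_single[OF True]
        by (cases "i = s \<alpha>") (simp_all add: mfps_coeff_X_mult g_def)
    next
      case False
      then have "i = s \<alpha> \<Longrightarrow> \<alpha> = 0"
        using s[of \<alpha>] by auto
      then show ?thesis
        using False order_geD[OF assms, of \<alpha>] by (auto simp: mfps_coeff_X_mult)
    qed
    then show "mfps_coeff h \<alpha> = mfps_coeff (\<Sum>i\<in>UNIV. mfps_X i * g i) \<alpha>"
      by simp
  qed
  moreover have "g i \<in> order_ge k" for i
    using order_geD[OF assms] by (simp add: order_ge_def g_def total_degree_add)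
  ultimately show ?thesis
    using that by blast
qed

section \<open>Ideals\<close>

lemma module_mult: "Modules.module ((*) :: 'a::comm_ring_1 \<Rightarrow> 'a \<Rightarrow> 'a)"
  by unfold_locales (simp_all add: algebra_simps)

lemmas ideal_of_base = module.span_base[OF module_mult, folded ideal_of_def]
  and ideal_of_zero = module.span_zero[OF module_mult, folded ideal_of_def]
  and ideal_of_add = module.span_add[OF module_mult, folded ideal_of_def]
  and ideal_of_sum = module.span_sum[OF module_mult, folded ideal_of_def]
  and ideal_of_scale = module.span_scale[OF module_mult, folded ideal_of_def]

lemma ideal_of_scale_right: "a \<in> ideal_of S \<Longrightarrow> a * r \<in> ideal_of S"
  using ideal_of_scale[of a S r] by (simp add: mult.commute)

lemma ideal_of_subset_order_ge:
  fixes S :: "('a::comm_ring_1, 'n::finite) mfps set"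
  assumes "S \<subseteq> order_ge k"
  shows "ideal_of S \<subseteq> order_ge k"
proof -
  have "module.subspace (*) (order_ge k :: ('a, 'n) mfps set)"
    using order_ge_mult[of _ 0 _ k]
    by (auto simp: module.subspace_def[OF module_mult] intro: order_ge_add)
  then show ?thesis
    unfolding ideal_of_def by (rule module.span_minimal[OF module_mult assms])
qed

lemma var_ideal_subset_order_ge: "var_ideal \<subseteq> order_ge 1"
  unfolding var_ideal_def by (rule ideal_of_subset_order_ge) (auto simp: X_in_order_ge)

text \<open>Turns membership in the maximal ideal into the vanishing of the constant
  coefficient.\<close>

lemma var_ideal_eq_order_ge: "var_ideal = order_ge 1"
proof
  show "order_ge 1 \<subseteq> (var_ideal :: ('a, 'b) mfps set)"
  proof
    fix h :: "('a, 'b) mfps"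
    assume "h \<in> order_ge 1"
    then obtain g where "h = (\<Sum>i\<in>UNIV. mfps_X i * g i)"
      using order_ge_Suc_decompose[of h 0] by auto
    then show "h \<in> var_ideal"
      unfolding var_ideal_def
      by (auto intro!: ideal_of_sum intro: ideal_of_scale_right[OF ideal_of_base])
  qed
qed (rule var_ideal_subset_order_ge)

lemma ideal_prod_var_ideal_subset: "ideal_prod var_ideal var_ideal \<subseteq> order_ge 2"
  unfolding ideal_prod_def var_ideal_eq_order_ge
  using order_ge_mult[of _ 1 _ 1] by (intro ideal_of_subset_order_ge) (auto simp: numeral_2_eq_2)

text \<open>Reduces a statement about infinite series to one about products of \<open>k\<close>
  variables. Each induction step splits off one variable and absorbs it into the multiplier
  \<open>q\<close>.\<close>

lemma order_ge_subset_ideal: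
  fixes I :: "('a::comm_ring_1, 'n::finite) mfps set"
  assumes "I = ideal_of S"
    and "\<And>xs. set xs \<subseteq> range mfps_X \<Longrightarrow> length xs = k \<Longrightarrow> q * prod_list xs \<in> I"
    and "h \<in> order_ge k"
  shows "q * h \<in> I"
  using assms(2,3)
proof (induction k arbitrary: q h)
  case 0
  from "0.prems"(1)[of "[]"] show ?case
    by (simp add: assms(1) ideal_of_scale_right)
next
  case (Suc k)
  obtain g where g: "\<And>i. g i \<in> order_ge k" "h = (\<Sum>i\<in>UNIV. mfps_X i * g i)"
    using order_ge_Suc_decompose[OF Suc.prems(2)] by metis
  have "(q * mfps_X i) * g i \<in> I" for i
  proof (rule Suc.IH[OF _ g(1)])
    fix xs :: "('a, 'n) mfps list"
    assume "set xs \<subseteq> range mfps_X" "length xs = k"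
    then show "q * mfps_X i * prod_list xs \<in> I"
      using Suc.prems(1)[of "mfps_X i # xs"] by (simp add: mult.assoc)
  qed
  then have "(\<Sum>i\<in>UNIV. q * mfps_X i * g i) \<in> I"
    unfolding assms(1) by (intro ideal_of_sum)
  then show ?case
    by (simp add: g(2) sum_distrib_left mult.assoc)
qed

section \<open>Quotients by ideals of finite colength\<close>

interpretation mfps_space: vector_space "\<lambda>c (h :: ('a::field, 'n::finite) mfps). mfps_const c * h"
  by unfold_locales
    (rule mfps_eqI, simp add: mfps_coeff_1 distrib_left distrib_right mult.assoc)+

text \<open>The inverse is the geometric series in \<open>h\<close>. It makes sense coefficientwise,
  since \<open>h ^ k\<close> has order at least \<open>k\<close> and only finitely many powers reach
  a given degree.\<close>

lemma mfps_inverse_one_minus: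
  fixes h :: "('a::comm_ring_1, 'n::finite) mfps"
  assumes "h \<in> order_ge 1"
  obtains w where "(1 - h) * w = 1"
proof -
  define w where "w = Abs_mfps (\<lambda>\<alpha>. \<Sum>k\<le>total_degree \<alpha>. mfps_coeff (h ^ k) \<alpha>)"
  have pow: "h ^ k \<in> order_ge k" for k
    using order_ge_power[OF assms, of k] by simp
  have approx: "w - (\<Sum>k\<le>K. h ^ k) \<in> order_ge (Suc K)" for K
    unfolding order_ge_def mem_Collect_eq
  proof (intro allI impI)
    fix \<alpha> :: "'n \<Rightarrow>\<^sub>0 nat"
    assume "total_degree \<alpha> < Suc K"
    then have "(\<Sum>k\<le>total_degree \<alpha>. mfps_coeff (h ^ k) \<alpha>) = (\<Sum>k\<le>K. mfps_coeff (h ^ k) \<alpha>)"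
      by (intro sum.mono_neutral_left) (auto intro: order_geD[OF pow])
    then show "mfps_coeff (w - (\<Sum>k\<le>K. h ^ k)) \<alpha> = 0"
      by (simp add: w_def)
  qed
  have "(1 - h) * w = 1"
  proof (rule mfps_eqI)
    fix \<alpha> :: "'n \<Rightarrow>\<^sub>0 nat"
    let ?K = "total_degree \<alpha>"
    \<comment> \<open>The series is cut at the degree of \<open>\<alpha>\<close>: the telescoped
      term \<open>h ^ Suc ?K\<close> and the tail both have order above this degree.\<close>
    have "(1 - h) * w = 1 - h ^ Suc ?K + (1 - h) * (w - (\<Sum>k\<le>?K. h ^ k))"
      unfolding right_diff_distrib using sum_gp_basic[of h ?K] by simp
    moreover have "mfps_coeff ((1 - h) * (w - (\<Sum>k\<le>?K. h ^ k))) \<alpha> = 0"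
      using order_ge_mult[OF order_ge_0 approx] by (rule order_geD) simp
    moreover have "mfps_coeff (h ^ Suc ?K) \<alpha> = 0"
      using pow by (rule order_geD) simp
    ultimately show "mfps_coeff ((1 - h) * w) \<alpha> = mfps_coeff 1 \<alpha>"
      by simp
  qed
  then show ?thesis
    using that by blast
qed

section \<open>Linear algebra modulo an ideal of finite colength\<close>

locale mfps_quotient =
  fixes S B :: "(complex, 'n::finite) mfps set"
  assumes basis: "quotient_basis (ideal_of S) B"
begin

lemma finite_basis: "finite B"
  using basis by (simp add: quotient_basis_def)

definition coords :: "(complex, 'n) mfps \<Rightarrow> (complex, 'n) mfps \<Rightarrow> complex" where
  "coords g = (THE c. (\<forall>b. b \<notin> B \<longrightarrow> c b = 0) \<and> g - (\<Sum>b\<in>B. mfps_const (c b) * b) \<in> ideal_of S)"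

text \<open>A linear retraction onto the span of \<open>B\<close> with kernel
  \<open>ideal_of S\<close>. It models the quotient inside the series ring, so that dimension
  arguments can use \<open>mfps_space\<close>.\<close>

definition proj :: "(complex, 'n) mfps \<Rightarrow> (complex, 'n) mfps" where
  "proj g = (\<Sum>b\<in>B. mfps_const (coords g b) * b)"

lemma coords:
  shows coords_outside: "b \<notin> B \<Longrightarrow> coords g b = 0"
    and diff_proj: "g - proj g \<in> ideal_of S"
proof -
  have "\<exists>!c. (\<forall>b. b \<notin> B \<longrightarrow> c b = 0) \<and> g - (\<Sum>b\<in>B. mfps_const (c b) * b) \<in> ideal_of S"
    using basis by (simp add: quotient_basis_def)
  from theI'[OF this] show "b \<notin> B \<Longrightarrow> coords g b = 0" "g - proj g \<in> ideal_of S"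
    unfolding proj_def coords_def by auto
qed

lemma coords_eqI:
  assumes "\<And>b. b \<notin> B \<Longrightarrow> c b = 0" "g - (\<Sum>b\<in>B. mfps_const (c b) * b) \<in> ideal_of S"
  shows "coords g = c"
proof -
  have "\<exists>!c. (\<forall>b. b \<notin> B \<longrightarrow> c b = 0) \<and> g - (\<Sum>b\<in>B. mfps_const (c b) * b) \<in> ideal_of S"
    using basis by (simp add: quotient_basis_def)
  then show ?thesis
    using assms coords_outside[of _ g] diff_proj[of g] unfolding proj_def by auto
qed

lemma proj_add: "proj (g + h) = proj g + proj h"
proof -
  have "coords (g + h) = (\<lambda>b. coords g b + coords h b)"
  proof (rule coords_eqI)
    have "g + h - (proj g + proj h) \<in> ideal_of S"
      using ideal_of_add[OF diff_proj[of g] diff_proj[of h]] by (simp add: algebra_simps)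
    then show "g + h - (\<Sum>b\<in>B. mfps_const (coords g b + coords h b) * b) \<in> ideal_of S"
      by (simp add: proj_def mfps_space.scale_left_distrib sum.distrib)
  qed (simp add: coords_outside)
  then show ?thesis
    by (simp add: proj_def mfps_space.scale_left_distrib sum.distrib)
qed

lemma proj_scale: "proj (mfps_const c * g) = mfps_const c * proj g"
proof -
  have "coords (mfps_const c * g) = (\<lambda>b. c * coords g b)"
  proof (rule coords_eqI)
    have "mfps_const c * (g - proj g) \<in> ideal_of S"
      by (rule ideal_of_scale[OF diff_proj])
    then show "mfps_const c * g - (\<Sum>b\<in>B. mfps_const (c * coords g b) * b) \<in> ideal_of S"
      by (simp add: proj_def mfps_space.scale_right_diff_distrib mfps_space.scale_sum_right)
  qed (simp add: coords_outside)
  then show ?thesis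
    by (simp add: proj_def mfps_space.scale_sum_right)
qed

lemma proj_eq_0_iff: "proj g = 0 \<longleftrightarrow> g \<in> ideal_of S"
proof
  assume "g \<in> ideal_of S"
  then have "coords g = (\<lambda>_. 0)"
    by (intro coords_eqI) simp_all
  then show "proj g = 0"
    by (simp add: proj_def)
qed (use diff_proj[of g] in simp)

lemma proj_0 [simp]: "proj 0 = 0"
  by (simp add: proj_eq_0_iff ideal_of_zero)

lemma proj_diff: "proj (g - h) = proj g - proj h"
  using proj_add[of "g - h" h] by (simp add: algebra_simps)

lemma proj_in_span: "proj g \<in> mfps_space.span B"
  unfolding proj_def
  by (intro mfps_space.span_sum mfps_space.span_scale mfps_space.span_base)

lemma proj_basis:
  assumes "b \<in> B"
  shows "proj b = b"
proof -
  have sum_eq: "(\<Sum>b'\<in>B. mfps_const (if b' = b then 1 else 0) * b') = b"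
    using assms finite_basis mfps_space.scale_one[of b]
    by (subst sum.remove[of _ b]) (auto intro: sum.neutral)
  then have "coords b = (\<lambda>b'. if b' = b then 1 else 0)"
    using assms by (intro coords_eqI) (auto simp: ideal_of_zero)
  then show ?thesis
    by (simp add: proj_def sum_eq)
qed

text \<open>A linear relation among the elements of \<open>B\<close> is a representation of 0, and
  coordinates are unique.\<close>

lemma independent_basis: "mfps_space.independent B"
proof (rule mfps_space.independent_if_scalars_zero[OF finite_basis])
  fix c b
  assume c: "(\<Sum>x\<in>B. mfps_const (c x) * x) = 0" and "b \<in> B"
  have "coords 0 = (\<lambda>x. if x \<in> B then c x else 0)"
    by (rule coords_eqI) (simp_all add: c ideal_of_zero cong: sum.cong)
  moreover have "coords 0 = (\<lambda>_. 0)"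
    by (rule coords_eqI) (simp_all add: ideal_of_zero)
  ultimately show "c b = 0"
    using \<open>b \<in> B\<close> by (metis (full_types))
qed

text \<open>
  The partial products \<open>q, q x\<^sub>1, q x\<^sub>1 x\<^sub>2, \<dots>\<close> are linearly independent modulo the ideal: a
  relation whose first term is \<open>p\<close> reads \<open>p (1 - h) \<in> I\<close> with \<open>h\<close> in the maximal ideal, and
  \<open>1 - h\<close> is a unit.
\<close>

lemma independent_partial_products:
  assumes "set xs \<subseteq> order_ge 1" "q * prod_list xs \<notin> ideal_of S"
  obtains T where "T \<subseteq> range (\<lambda>r. proj (q * r))" "mfps_space.independent T"
    "finite T" "card T = Suc (length xs)"
  using assms
proof (induction xs arbitrary: q thesis)
  case Nil
  then have "proj q \<noteq> 0"
    by (simp add: proj_eq_0_iff)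
  moreover have "{proj q} \<subseteq> range (\<lambda>r. proj (q * r))"
    by (auto intro: range_eqI[of _ _ 1])
  ultimately show ?case
    by (intro Nil.prems(1)[of "{proj q}"]) simp_all
next
  case (Cons x xs)
  let ?R = "range (\<lambda>r. proj (q * x * r))"
  obtain T where T: "T \<subseteq> ?R" "mfps_space.independent T" "finite T" "card T = Suc (length xs)"
    using Cons.IH[of "q * x"] Cons.prems(2,3) by (auto simp: mult.assoc)
  \<comment> \<open>\<open>?R\<close> is the image of the ideal generated by \<open>q * x\<close>.
    As it is a subspace, a whole linear combination of \<open>T\<close> collapses to a single
    \<open>proj (q * x * r)\<close>.\<close>
  have "mfps_space.subspace ?R"
  proof (rule mfps_space.subspaceI)
    show "0 \<in> ?R"
      by (rule range_eqI[of _ _ 0]) simp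
    show "g + h \<in> ?R" if "g \<in> ?R" "h \<in> ?R" for g h
      using that by (auto simp flip: proj_add distrib_left)
    show "mfps_const c * g \<in> ?R" if "g \<in> ?R" for c g
      using that by (auto simp flip: proj_scale) (metis mult.left_commute rangeI)
  qed
  then have span_T: "mfps_space.span T \<subseteq> ?R"
    using T(1) by (rule mfps_space.span_minimal[rotated])
  have notin: "proj q \<notin> mfps_space.span T"
  proof
    assume "proj q \<in> mfps_space.span T"
    then obtain r where "proj q = proj (q * x * r)"
      using span_T by blast
    then have "proj (q * (1 - x * r)) = 0"
      by (simp add: right_diff_distrib proj_diff mult.assoc)
    then have in_ideal: "q * (1 - x * r) \<in> ideal_of S"
      by (simp add: proj_eq_0_iff)
    have "x * r \<in> order_ge 1"
      using order_ge_mult[of x 1 r 0] Cons.prems(2) by simp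
    then obtain w where "(1 - x * r) * w = 1"
      by (rule mfps_inverse_one_minus)
    then have "q \<in> ideal_of S"
      using ideal_of_scale_right[OF in_ideal, of w] by (simp add: mult.assoc)
    then show False
      using Cons.prems(3) by (simp add: ideal_of_scale_right)
  qed
  show ?case
  proof (rule Cons.prems(1))
    show "insert (proj q) T \<subseteq> range (\<lambda>r. proj (q * r))"
      using T(1) by (auto simp: mult.assoc intro: range_eqI[of _ _ 1])
    show "mfps_space.independent (insert (proj q) T)"
      using notin T(2) by (auto simp: mfps_space.independent_insert)
    have "proj q \<notin> T"
      using notin mfps_space.span_base by blast
    then show "card (insert (proj q) T) = Suc (length (x # xs))"
      using T(3,4) by simp
  qed (use T(3) in simp)
qed

text \<open>If a product of \<open>card B\<close> variables were outside the ideal, its partial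
  products, starting with the empty one, would give \<open>card B + 1\<close> independent vectors in
  the span of \<open>B\<close>.\<close>

lemma order_ge_card_basis_subset: "order_ge (card B) \<subseteq> ideal_of S"
proof
  fix h :: "(complex, 'n) mfps"
  assume h: "h \<in> order_ge (card B)"
  have "1 * h \<in> ideal_of S"
  proof (rule order_ge_subset_ideal[OF refl _ h], rule ccontr)
    fix xs :: "(complex, 'n) mfps list"
    assume xs: "set xs \<subseteq> range mfps_X" "length xs = card B" "1 * prod_list xs \<notin> ideal_of S"
    have "set xs \<subseteq> order_ge 1"
      using xs(1) X_in_order_ge by auto
    then obtain T where T: "T \<subseteq> range (\<lambda>r. proj (1 * r))" "mfps_space.independent T"
        "card T = Suc (length xs)"
      using xs(3) by (rule independent_partial_products)
    have "T \<subseteq> mfps_space.span B"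
      using T(1) proj_in_span by auto
    then show False
      using mfps_space.independent_span_bound[OF finite_basis T(2)] T(3) xs(2) by simp
  qed
  then show "h \<in> ideal_of S"
    by simp
qed

text \<open>The products \<open>f ^ i * b\<close> with \<open>i < e\<close> and
  \<open>b \<in> B'\<close> span the quotient: expanding the remainder repeatedly in
  \<open>B'\<close> pushes it into the multiples of \<open>f ^ e\<close>, which lie in the
  ideal.\<close>

lemma card_basis_le:
  assumes B': "quotient_basis (ideal_of (ideal_of S \<union> {f})) B'" and fe: "f ^ e \<in> ideal_of S"
  shows "card B \<le> e * card B'"
proof -
  let ?G = "\<lambda>m. (\<lambda>(i, b). f ^ i * b) ` ({..<m} \<times> B')"
  have finB': "finite B'"
    using B' by (simp add: quotient_basis_def)
  have expand: "\<exists>s\<in>mfps_space.span (?G m). \<exists>r. g - s - f ^ m * r \<in> ideal_of S" for m g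
  proof (induction m)
    case 0
    show ?case
      by (intro bexI[of _ 0] exI[of _ g]) (simp_all add: ideal_of_zero mfps_space.span_zero)
  next
    case (Suc m)
    then obtain s r where s: "s \<in> mfps_space.span (?G m)" and r: "g - s - f ^ m * r \<in> ideal_of S"
      by blast
    obtain c where "r - (\<Sum>b\<in>B'. mfps_const (c b) * b) \<in> ideal_of (ideal_of S \<union> {f})"
      using B' unfolding quotient_basis_def by blast
    \<comment> \<open>An element of the enlarged ideal is an element of \<open>ideal_of S\<close>
      plus a multiple \<open>a * f\<close>; this \<open>a\<close> is the next remainder.\<close>
    then obtain a where a: "r - (\<Sum>b\<in>B'. mfps_const (c b) * b) - a * f \<in> ideal_of S"
      unfolding ideal_of_def Un_insert_right Un_empty_right
        module.span_insert[OF module_mult] module.span_span[OF module_mult] by blast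
    let ?t = "\<Sum>b\<in>B'. mfps_const (c b) * (f ^ m * b)"
    have "mfps_space.span (?G m) \<subseteq> mfps_space.span (?G (Suc m))"
      by (intro mfps_space.span_mono image_mono Sigma_mono) auto
    moreover have "?t \<in> mfps_space.span (?G (Suc m))"
      by (intro mfps_space.span_sum mfps_space.span_scale mfps_space.span_base) auto
    ultimately have st: "s + ?t \<in> mfps_space.span (?G (Suc m))"
      using s by (intro mfps_space.span_add) auto
    have t: "?t = f ^ m * (\<Sum>b\<in>B'. mfps_const (c b) * b)"
      by (simp add: sum_distrib_left mult.left_commute)
    have eq: "g - (s + ?t) - f ^ Suc m * a =
        (g - s - f ^ m * r) + f ^ m * (r - (\<Sum>b\<in>B'. mfps_const (c b) * b) - a * f)"
      unfolding t by (simp add: algebra_simps)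
    have "g - (s + ?t) - f ^ Suc m * a \<in> ideal_of S"
      unfolding eq by (rule ideal_of_add[OF r ideal_of_scale[OF a]])
    then show ?case
      using st by blast
  qed
  let ?T = "proj ` ?G e"
  have span_T: "proj s \<in> mfps_space.span ?T" if "s \<in> mfps_space.span (?G e)" for s
  proof -
    have "mfps_space.subspace {s. proj s \<in> mfps_space.span ?T}"
      by (rule mfps_space.subspaceI)
        (auto simp: proj_add proj_scale
          intro: mfps_space.span_zero mfps_space.span_add mfps_space.span_scale)
    moreover have "?G e \<subseteq> {s. proj s \<in> mfps_space.span ?T}"
      using mfps_space.span_base[of _ ?T] by blast
    ultimately have "mfps_space.span (?G e) \<subseteq> {s. proj s \<in> mfps_space.span ?T}"
      by (intro mfps_space.span_minimal)
    then show ?thesis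
      using that by blast
  qed
  have "B \<subseteq> mfps_space.span ?T"
  proof
    fix b
    assume b: "b \<in> B"
    obtain s r where s: "s \<in> mfps_space.span (?G e)" and r: "b - s - f ^ e * r \<in> ideal_of S"
      using expand by blast
    have "b - s \<in> ideal_of S"
      using ideal_of_add[OF r ideal_of_scale_right[OF fe, of r]] by simp
    then have "proj b = proj s"
      by (simp add: proj_diff flip: proj_eq_0_iff)
    then show "b \<in> mfps_space.span ?T"
      using span_T[OF s] proj_basis[OF b] by simp
  qed
  moreover have "finite (?G e)"
    using finB' by simp
  ultimately have "card B \<le> card ?T"
    using mfps_space.independent_span_bound[OF _ independent_basis] by blast
  also have "\<dots> \<le> card (?G e)"
    by (rule card_image_le) fact
  also have "\<dots> \<le> card ({..<e} \<times> B')"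
    using finB' by (intro card_image_le) simp
  finally show ?thesis
    by (simp add: card_cartesian_product)
qed

end

section \<open>Derivations and polynomial expressions\<close>

lemma sum_keys_eq_sum_superset:
  fixes P :: "'a \<Rightarrow>\<^sub>0 'b::zero" and g :: "'a \<Rightarrow> 'b \<Rightarrow> 'c::comm_monoid_add"
  assumes "finite F" "Poly_Mapping.keys P \<subseteq> F" "\<And>\<alpha>. g \<alpha> 0 = 0"
  shows "(\<Sum>\<alpha>\<in>Poly_Mapping.keys P. g \<alpha> (Poly_Mapping.lookup P \<alpha>)) =
    (\<Sum>\<alpha>\<in>F. g \<alpha> (Poly_Mapping.lookup P \<alpha>))"
  using assms by (intro sum.mono_neutral_left) (auto simp: in_keys_iff)

lemma poly_mapping_sum_singles:
  "(\<Sum>\<alpha>\<in>Poly_Mapping.keys P. Poly_Mapping.single \<alpha> (Poly_Mapping.lookup P \<alpha>)) = P"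
  by (rule poly_mapping_eqI)
    (simp add: lookup_sum lookup_single when_def in_keys_iff sum.delta' cong: if_cong)

text \<open>Used for two subrings of the fraction field: the chart ring \<open>adjoin ys\<close> and
  the valuation ring.\<close>

locale closed_subring =
  fixes S :: "'a::comm_ring_1 set"
  assumes one_closed: "1 \<in> S"
    and uminus_closed: "a \<in> S \<Longrightarrow> - a \<in> S"
    and add_closed: "a \<in> S \<Longrightarrow> b \<in> S \<Longrightarrow> a + b \<in> S"
    and mult_closed: "a \<in> S \<Longrightarrow> b \<in> S \<Longrightarrow> a * b \<in> S"
begin

lemma zero_closed: "0 \<in> S"
  using add_closed[OF one_closed uminus_closed[OF one_closed]] by simp

lemma diff_closed: "a \<in> S \<Longrightarrow> b \<in> S \<Longrightarrow> a - b \<in> S"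
  using add_closed[OF _ uminus_closed, of a b] by simp

lemma sum_closed: "(\<And>i. i \<in> A \<Longrightarrow> g i \<in> S) \<Longrightarrow> sum g A \<in> S"
  by (induction A rule: infinite_finite_induct) (auto intro: zero_closed add_closed)

lemma prod_closed: "(\<And>i. i \<in> A \<Longrightarrow> g i \<in> S) \<Longrightarrow> prod g A \<in> S"
  by (induction A rule: infinite_finite_induct) (auto intro: one_closed mult_closed)

lemma power_closed: "a \<in> S \<Longrightarrow> a ^ k \<in> S"
  by (induction k) (auto intro: one_closed mult_closed)

lemma of_nat_closed: "of_nat k \<in> S"
  by (induction k) (auto intro: zero_closed one_closed add_closed)

text \<open>By the Leibniz formula the determinant is a sum of signed products of entries.\<close>

lemma det_closed:
  assumes "M \<in> carrier_mat m m" "\<And>i j. i < m \<Longrightarrow> j < m \<Longrightarrow> M $$ (i, j) \<in> S"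
  shows "det M \<in> S"
proof -
  have "signof p \<in> S" for p :: "nat \<Rightarrow> nat"
    by (auto simp: sign_def intro: one_closed uminus_closed)
  moreover have "p i < m" if "p permutes {0..<m}" "i \<in> {0..<m}" for p i
    using that permutes_in_image by fastforce
  ultimately show ?thesis
    unfolding det_def'[OF assms(1)]
    by (intro sum_closed mult_closed prod_closed assms(2)) auto
qed

end

text \<open>Covers the partial derivatives of series, their extensions to the fraction field and
  multiples of these extensions.\<close>

locale derivation =
  fixes D :: "'a::comm_ring_1 \<Rightarrow> 'a"
  assumes add: "D (x + y) = D x + D y"
    and mult: "D (x * y) = D x * y + x * D y"
begin

lemma zero [simp]: "D 0 = 0"
  using add[of 0 0] by simp

lemma one [simp]: "D 1 = 0"
  using mult[of 1 1] by simp

lemma sum: "D (\<Sum>i\<in>A. g i) = (\<Sum>i\<in>A. D (g i))"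
  by (induction A rule: infinite_finite_induct) (auto simp: add)

text \<open>At \<open>k = 0\<close> the truncated exponent is harmless, as the factor
  \<open>of_nat k\<close> is 0.\<close>

lemma power: "D (x ^ k) = of_nat k * x ^ (k - 1) * D x"
proof (induction k)
  case (Suc k)
  then show ?case
    by (cases k) (simp_all add: mult algebra_simps)
qed simp

lemma prod:
  assumes "finite A"
  shows "D (\<Prod>i\<in>A. g i) = (\<Sum>j\<in>A. (\<Prod>i\<in>A - {j}. g i) * D (g j))"
  using assms
proof (induction A rule: finite_induct)
  case (insert a A)
  have "(\<Prod>i\<in>insert a A - {j}. g i) = g a * (\<Prod>i\<in>A - {j}. g i)" if "j \<in> A" for j
  proof -
    have "insert a A - {j} = insert a (A - {j})"
      using insert.hyps that by auto
    then show ?thesis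
      using insert.hyps by simp
  qed
  moreover have "insert a A - {a} = A"
    using insert.hyps by auto
  ultimately show ?case
    using insert by (simp add: mult sum_distrib_left algebra_simps)
qed simp

end

lemma fract_as_quotient:
  fixes z :: "'a::idom fract"
  obtains a b where "b \<noteq> 0" "z = to_fract a / to_fract b"
  by (cases z) (auto simp: Fract_conv_to_fract)

text \<open>The extension is given by the quotient rule. Once the rule is known for every
  representation of a fraction, additivity and the Leibniz rule follow by clearing
  denominators.\<close>

lemma derivation_extends_to_fract:
  fixes D :: "'a::idom \<Rightarrow> 'a"
  assumes "derivation D"
  obtains E where "derivation E" "\<And>a. E (to_fract a) = to_fract (D a)"
proof -
  interpret derivation D by fact
  have "\<forall>z::'a fract. \<exists>a b. b \<noteq> 0 \<and> z = to_fract a / to_fract b"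
    by (metis fract_as_quotient)
  then obtain num den :: "'a fract \<Rightarrow> 'a"
    where den: "\<And>z. den z \<noteq> 0" and nd: "\<And>z. z = to_fract (num z) / to_fract (den z)"
    by metis
  define E where "E z = (to_fract (D (num z)) - z * to_fract (D (den z))) / to_fract (den z)" for z
  \<comment> \<open>Independence of the chosen representative: \<open>D\<close> is applied to the
    cross-multiplied identity \<open>?n * b = a * ?d\<close>.\<close>
  have E: "to_fract b * E z = to_fract (D a) - z * to_fract (D b)"
    if za: "z * to_fract b = to_fract a" for z a b
  proof -
    let ?n = "num z" and ?d = "den z"
    have d0: "to_fract ?d \<noteq> 0"
      using den by simp
    have zn: "to_fract ?n = z * to_fract ?d"
      using nd[of z] d0 by (simp add: field_simps)
    have "to_fract (?n * b) = to_fract (a * ?d)"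
      by (simp add: zn za[symmetric])
    then have "D (?n * b) = D (a * ?d)"
      unfolding to_fract_eq_iff by (rule arg_cong)
    then have *: "D ?n * b + ?n * D b = D a * ?d + a * D ?d"
      by (simp add: mult)
    have "to_fract (D ?n) * to_fract b + z * to_fract ?d * to_fract (D b) =
        to_fract (D a) * to_fract ?d + z * to_fract b * to_fract (D ?d)"
      using arg_cong[OF *, of to_fract] by (simp add: zn za)
    then have bDn: "to_fract b * to_fract (D ?n) = to_fract ?d * to_fract (D a) +
        to_fract b * (z * to_fract (D ?d)) - to_fract ?d * (z * to_fract (D b))"
      by (simp add: eq_diff_eq ac_simps)
    have "to_fract ?d * E z = to_fract (D ?n) - z * to_fract (D ?d)"
      using d0 by (simp add: E_def)
    then have "to_fract ?d * (to_fract b * E z) = to_fract b * (to_fract (D ?n) - z * to_fract (D ?d))"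
      by (simp add: mult.left_commute)
    also have "\<dots> = to_fract ?d * (to_fract (D a) - z * to_fract (D b))"
      by (simp add: right_diff_distrib bDn)
    finally have "to_fract ?d * (to_fract b * E z) = to_fract ?d * (to_fract (D a) - z * to_fract (D b))" .
    then show ?thesis
      using d0 by simp
  qed
  have "E (to_fract a) = to_fract (D a)" for a
    using E[of "to_fract a" 1 a] by simp
  moreover have "derivation E"
  proof
    fix x y :: "'a fract"
    obtain a b where x: "b \<noteq> 0" "x * to_fract b = to_fract a"
      by (rule fract_as_quotient[of x]) (auto simp: field_simps)
    obtain c d where y: "d \<noteq> 0" "y * to_fract d = to_fract c"
      by (rule fract_as_quotient[of y]) (auto simp: field_simps)
    have bd: "to_fract (b * d) \<noteq> 0"
      using x(1) y(1) by simp
    note Ex = E[OF x(2)] and Ey = E[OF y(2)]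
    have "to_fract (b * d) * E (x + y) = to_fract (D (a * d + c * b)) - (x + y) * to_fract (D (b * d))"
      by (rule E) (simp add: x(2)[symmetric] y(2)[symmetric] algebra_simps)
    also have "\<dots> = to_fract d * (to_fract b * E x) + to_fract b * (to_fract d * E y)"
      unfolding Ex Ey by (simp add: mult add x(2)[symmetric] y(2)[symmetric] algebra_simps)
    also have "\<dots> = to_fract (b * d) * (E x + E y)"
      by (simp add: algebra_simps)
    finally show "E (x + y) = E x + E y"
      using bd by simp
    have "to_fract (b * d) * E (x * y) = to_fract (D (a * c)) - (x * y) * to_fract (D (b * d))"
      by (rule E) (simp add: x(2)[symmetric] y(2)[symmetric] algebra_simps)
    also have "\<dots> = (y * to_fract d) * (to_fract b * E x) + (x * to_fract b) * (to_fract d * E y)"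
      unfolding Ex Ey by (simp add: mult add x(2)[symmetric] y(2)[symmetric] algebra_simps)
    also have "\<dots> = to_fract (b * d) * (E x * y + x * E y)"
      by (simp add: algebra_simps)
    finally show "E (x * y) = E x * y + x * E y"
      using bd by simp
  qed
  ultimately show ?thesis
    using that by blast
qed

section \<open>Polynomial evaluation and the chain rule\<close>

definition monomial_eval :: "'a::idom fract list \<Rightarrow> (nat \<Rightarrow>\<^sub>0 nat) \<Rightarrow> 'a fract" where
  "monomial_eval ys \<alpha> = (\<Prod>i\<in>Poly_Mapping.keys \<alpha>. (ys ! i) ^ Poly_Mapping.lookup \<alpha> i)"

lemma monomial_eval_eq:
  assumes "finite F" "Poly_Mapping.keys \<alpha> \<subseteq> F"
  shows "monomial_eval ys \<alpha> = (\<Prod>i\<in>F. (ys ! i) ^ Poly_Mapping.lookup \<alpha> i)"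
  unfolding monomial_eval_def using assms
  by (intro prod.mono_neutral_left) (auto simp: in_keys_iff)

lemma monomial_eval_0 [simp]: "monomial_eval ys 0 = 1"
  by (simp add: monomial_eval_def)

lemma monomial_eval_single [simp]: "monomial_eval ys (Poly_Mapping.single i (Suc 0)) = ys ! i"
  by (simp add: monomial_eval_def)

lemma monomial_eval_add: "monomial_eval ys (\<alpha> + \<beta>) = monomial_eval ys \<alpha> * monomial_eval ys \<beta>"
proof -
  let ?F = "Poly_Mapping.keys \<alpha> \<union> Poly_Mapping.keys \<beta>"
  have "monomial_eval ys (\<alpha> + \<beta>) = (\<Prod>i\<in>?F. (ys ! i) ^ Poly_Mapping.lookup (\<alpha> + \<beta>) i)"
    by (intro monomial_eval_eq keys_add) simp
  also have "\<dots> = monomial_eval ys \<alpha> * monomial_eval ys \<beta>"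
    by (simp add: lookup_add power_add prod.distrib monomial_eval_eq[of ?F])
  finally show ?thesis .
qed

lemma poly_eval_eq:
  assumes "finite F" "Poly_Mapping.keys P \<subseteq> F"
  shows "poly_eval ys P = (\<Sum>\<alpha>\<in>F. to_fract (Poly_Mapping.lookup P \<alpha>) * monomial_eval ys \<alpha>)"
  unfolding poly_eval_def monomial_eval_def[symmetric] using assms
  by (rule sum_keys_eq_sum_superset) simp

lemma poly_eval_0 [simp]: "poly_eval ys 0 = 0"
  by (simp add: poly_eval_def)

lemma poly_eval_add: "poly_eval ys (P + Q) = poly_eval ys P + poly_eval ys Q"
proof -
  let ?F = "Poly_Mapping.keys P \<union> Poly_Mapping.keys Q"
  have "poly_eval ys (P + Q) = (\<Sum>\<alpha>\<in>?F. to_fract (Poly_Mapping.lookup (P + Q) \<alpha>) * monomial_eval ys \<alpha>)"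
    by (intro poly_eval_eq keys_add) simp
  also have "\<dots> = poly_eval ys P + poly_eval ys Q"
    by (simp add: lookup_add sum.distrib poly_eval_eq[of ?F] distrib_right)
  finally show ?thesis .
qed

lemma poly_eval_sum: "poly_eval ys (\<Sum>i\<in>A. P i) = (\<Sum>i\<in>A. poly_eval ys (P i))"
  by (induction A rule: infinite_finite_induct) (simp_all add: poly_eval_add)

lemma poly_eval_single [simp]:
  "poly_eval ys (Poly_Mapping.single \<alpha> c) = to_fract c * monomial_eval ys \<alpha>"
  by (subst poly_eval_eq[of "{\<alpha>}"]) auto

lemma poly_eval_mult: "poly_eval ys (P * Q) = poly_eval ys P * poly_eval ys Q"
proof -
  let ?p = "Poly_Mapping.lookup P" and ?q = "Poly_Mapping.lookup Q"
  have "poly_eval ys (P * Q) = poly_eval ys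
      ((\<Sum>\<alpha>\<in>Poly_Mapping.keys P. Poly_Mapping.single \<alpha> (?p \<alpha>)) *
       (\<Sum>\<beta>\<in>Poly_Mapping.keys Q. Poly_Mapping.single \<beta> (?q \<beta>)))"
    by (simp add: poly_mapping_sum_singles)
  also have "\<dots> = (\<Sum>\<alpha>\<in>Poly_Mapping.keys P. to_fract (?p \<alpha>) * monomial_eval ys \<alpha>) *
      (\<Sum>\<beta>\<in>Poly_Mapping.keys Q. to_fract (?q \<beta>) * monomial_eval ys \<beta>)"
    by (simp add: sum_product poly_eval_sum mult_single monomial_eval_add ac_simps)
  also have "\<dots> = poly_eval ys P * poly_eval ys Q"
    by (simp add: poly_eval_def monomial_eval_def)
  finally show ?thesis .
qed

lemma poly_eval_poly_deriv:
  "poly_eval ys (poly_deriv j P) = (\<Sum>\<alpha>\<in>Poly_Mapping.keys P.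
     of_nat (Poly_Mapping.lookup \<alpha> j) * to_fract (Poly_Mapping.lookup P \<alpha>) *
     monomial_eval ys (\<alpha> - Poly_Mapping.single j 1))"
proof -
  have "to_fract (of_nat k :: 'a) = of_nat k" for k
    by (induction k) simp_all
  then show ?thesis
    by (simp add: poly_deriv_def poly_eval_sum)
qed

text \<open>If the variable \<open>j\<close> does not occur in the monomial, truncated subtraction
  leaves \<open>\<alpha>\<close> unchanged, but the coefficient \<open>of_nat 0\<close> removes the
  term.\<close>

lemma derivation_monomial_eval:
  assumes "derivation E" "Poly_Mapping.keys \<alpha> \<subseteq> {..<m}"
  shows "E (monomial_eval ys \<alpha>) = (\<Sum>j<m. of_nat (Poly_Mapping.lookup \<alpha> j) *
    monomial_eval ys (\<alpha> - Poly_Mapping.single j 1) * E (ys ! j))"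
proof -
  interpret derivation E by fact
  have "E (monomial_eval ys \<alpha>) = (\<Sum>j<m. (\<Prod>i\<in>{..<m} - {j}. (ys ! i) ^ Poly_Mapping.lookup \<alpha> i) *
      (of_nat (Poly_Mapping.lookup \<alpha> j) * (ys ! j) ^ (Poly_Mapping.lookup \<alpha> j - 1) * E (ys ! j)))"
    by (simp add: monomial_eval_eq[OF finite_lessThan assms(2)] prod power)
  also have "\<dots> = (\<Sum>j<m. of_nat (Poly_Mapping.lookup \<alpha> j) *
      monomial_eval ys (\<alpha> - Poly_Mapping.single j 1) * E (ys ! j))"
  proof (rule sum.cong[OF refl])
    fix j
    assume j: "j \<in> {..<m}"
    let ?\<beta> = "\<alpha> - Poly_Mapping.single j 1"
    have "Poly_Mapping.keys ?\<beta> \<subseteq> {..<m}"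
      using assms(2) by (auto simp: in_keys_iff lookup_minus subset_iff)
    then have "monomial_eval ys ?\<beta> = (\<Prod>i<m. (ys ! i) ^ Poly_Mapping.lookup ?\<beta> i)"
      by (intro monomial_eval_eq) auto
    also have "\<dots> = (ys ! j) ^ Poly_Mapping.lookup ?\<beta> j *
        (\<Prod>i\<in>{..<m} - {j}. (ys ! i) ^ Poly_Mapping.lookup ?\<beta> i)"
      using j by (intro prod.remove) auto
    also have "(\<Prod>i\<in>{..<m} - {j}. (ys ! i) ^ Poly_Mapping.lookup ?\<beta> i) =
        (\<Prod>i\<in>{..<m} - {j}. (ys ! i) ^ Poly_Mapping.lookup \<alpha> i)"
      by (intro prod.cong) (auto simp: lookup_minus lookup_single when_def)
    finally show "(\<Prod>i\<in>{..<m} - {j}. (ys ! i) ^ Poly_Mapping.lookup \<alpha> i) *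
        (of_nat (Poly_Mapping.lookup \<alpha> j) * (ys ! j) ^ (Poly_Mapping.lookup \<alpha> j - 1) * E (ys ! j)) =
        of_nat (Poly_Mapping.lookup \<alpha> j) * monomial_eval ys ?\<beta> * E (ys ! j)"
      by (simp add: lookup_minus)
  qed
  finally show ?thesis .
qed

text \<open>The chain rule: the first sum differentiates the coefficients, the second one the
  arguments \<open>ys\<close>.\<close>

lemma derivation_poly_eval:
  fixes D :: "'a::idom \<Rightarrow> 'a"
  assumes "derivation E" "\<And>a. E (to_fract a) = to_fract (D a)" "P \<in> polys m"
  shows "E (poly_eval ys P) =
    (\<Sum>\<alpha>\<in>Poly_Mapping.keys P. to_fract (D (Poly_Mapping.lookup P \<alpha>)) * monomial_eval ys \<alpha>) +
    (\<Sum>j<m. poly_eval ys (poly_deriv j P) * E (ys ! j))"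
proof -
  interpret derivation E by fact
  let ?K = "Poly_Mapping.keys P" and ?p = "Poly_Mapping.lookup P"
  have keys: "Poly_Mapping.keys \<alpha> \<subseteq> {..<m}" if "\<alpha> \<in> ?K" for \<alpha>
    using assms(3) that by (auto simp: polys_def)
  have "E (poly_eval ys P) = (\<Sum>\<alpha>\<in>?K. to_fract (D (?p \<alpha>)) * monomial_eval ys \<alpha>) +
      (\<Sum>\<alpha>\<in>?K. to_fract (?p \<alpha>) * E (monomial_eval ys \<alpha>))"
    by (simp add: poly_eval_eq[OF _ order.refl] sum mult assms(2) sum.distrib)
  also have "(\<Sum>\<alpha>\<in>?K. to_fract (?p \<alpha>) * E (monomial_eval ys \<alpha>)) =
      (\<Sum>\<alpha>\<in>?K. \<Sum>j<m. of_nat (Poly_Mapping.lookup \<alpha> j) * to_fract (?p \<alpha>) *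
        monomial_eval ys (\<alpha> - Poly_Mapping.single j 1) * E (ys ! j))"
    by (rule sum.cong[OF refl])
      (simp add: derivation_monomial_eval[OF assms(1) keys] sum_distrib_left ac_simps)
  also have "\<dots> = (\<Sum>j<m. poly_eval ys (poly_deriv j P) * E (ys ! j))"
    unfolding poly_eval_poly_deriv sum_distrib_right by (rule sum.swap)
  finally show ?thesis .
qed

section \<open>The chart ring and its Jacobian minors\<close>

lemma poly_eval_in_adjoin: "P \<in> polys (length ys) \<Longrightarrow> poly_eval ys P \<in> adjoin ys"
  by (auto simp: adjoin_def)

lemma single_0_in_polys: "Poly_Mapping.single 0 c \<in> polys m"
  by (simp add: polys_def)

lemma single_single_in_polys:
  "i < m \<Longrightarrow> Poly_Mapping.single (Poly_Mapping.single i k) c \<in> polys m"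
  by (simp add: polys_def)

lemma polys_add: "P \<in> polys m \<Longrightarrow> Q \<in> polys m \<Longrightarrow> P + Q \<in> polys m"
  unfolding polys_def using keys_add[of P Q] by blast

lemma polys_mult:
  assumes "P \<in> polys m" "Q \<in> polys m"
  shows "P * Q \<in> polys m"
  unfolding polys_def mem_Collect_eq
proof
  fix \<alpha>
  assume "\<alpha> \<in> Poly_Mapping.keys (P * Q)"
  then obtain \<beta> \<gamma> where "\<alpha> = \<beta> + \<gamma>" "\<beta> \<in> Poly_Mapping.keys P" "\<gamma> \<in> Poly_Mapping.keys Q"
    using keys_mult[of P Q] by blast
  then show "Poly_Mapping.keys \<alpha> \<subseteq> {..<m}"
    using assms keys_add[of \<beta> \<gamma>] unfolding polys_def by blast
qed

lemma to_fract_in_adjoin: "to_fract a \<in> adjoin ys"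
  using poly_eval_in_adjoin[OF single_0_in_polys, of ys a] by simp

lemma nth_in_adjoin: "i < length ys \<Longrightarrow> ys ! i \<in> adjoin ys"
  using poly_eval_in_adjoin[OF single_single_in_polys, of i ys "Suc 0" 1] by simp

lemma closed_subring_adjoin: "closed_subring (adjoin ys)"
proof
  show "1 \<in> adjoin ys"
    using to_fract_in_adjoin[of 1] by simp
  show add: "a + b \<in> adjoin ys" if "a \<in> adjoin ys" "b \<in> adjoin ys" for a b
    using that unfolding adjoin_def by (auto simp flip: poly_eval_add intro: polys_add)
  show mult: "a * b \<in> adjoin ys" if "a \<in> adjoin ys" "b \<in> adjoin ys" for a b
    using that unfolding adjoin_def by (auto simp flip: poly_eval_mult intro: polys_mult)
  show "- a \<in> adjoin ys" if "a \<in> adjoin ys" for a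
    using mult[OF to_fract_in_adjoin that, of "- 1"] by simp
qed

lemma monomial_eval_in_adjoin:
  assumes "Poly_Mapping.keys \<alpha> \<subseteq> {..<length ys}"
  shows "monomial_eval ys \<alpha> \<in> adjoin ys"
proof -
  interpret closed_subring "adjoin ys"
    by (rule closed_subring_adjoin)
  show ?thesis
    unfolding monomial_eval_def using assms by (auto intro!: prod_closed power_closed nth_in_adjoin)
qed

lemma poly_deriv_eval_in_adjoin:
  assumes "P \<in> polys (length ys)"
  shows "poly_eval ys (poly_deriv j P) \<in> adjoin ys"
proof -
  interpret closed_subring "adjoin ys"
    by (rule closed_subring_adjoin)
  have "Poly_Mapping.keys (\<alpha> - Poly_Mapping.single j 1) \<subseteq> {..<length ys}"
    if "\<alpha> \<in> Poly_Mapping.keys P" for \<alpha>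
    using assms that by (auto simp: polys_def in_keys_iff lookup_minus subset_iff)
  then show ?thesis
    unfolding poly_eval_poly_deriv
    by (intro sum_closed mult_closed of_nat_closed to_fract_in_adjoin monomial_eval_in_adjoin)
qed

lemma jacobian_minor_in_adjoin:
  assumes "M \<in> jacobian_minors ys"
  shows "M \<in> adjoin ys"
proof -
  interpret closed_subring "adjoin ys"
    by (rule closed_subring_adjoin)
  show ?thesis
    using assms unfolding jacobian_minors_def chart_relations_def
    by (auto intro!: det_closed poly_deriv_eval_in_adjoin)
qed

text \<open>
  Differentiating the relations \<open>P\<^sub>i(y) = 0\<close> gives a linear system for the derivatives of the
  generators \<open>y\<^sub>j\<close> with coefficients and right-hand side in the subring, so by Cramer's rule its
  determinant is a common denominator of these derivatives.
\<close>

lemma jacobian_minor_derivation_adjoin: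
  fixes D :: "'a::idom \<Rightarrow> 'a"
  assumes E: "derivation E" "\<And>a. E (to_fract a) = to_fract (D a)"
    and M: "M \<in> jacobian_minors ys" and z: "z \<in> adjoin ys"
  shows "M * E z \<in> adjoin ys"
proof -
  interpret closed_subring "adjoin ys"
    by (rule closed_subring_adjoin)
  interpret derivation E by fact
  let ?m = "length ys"
  have const: "(\<Sum>\<alpha>\<in>Poly_Mapping.keys P. to_fract (D (Poly_Mapping.lookup P \<alpha>)) * monomial_eval ys \<alpha>)
      \<in> adjoin ys" if "P \<in> polys ?m" for P
    using that
    by (intro sum_closed mult_closed to_fract_in_adjoin monomial_eval_in_adjoin) (auto simp: polys_def)
  obtain P where P: "\<And>i. i < ?m \<Longrightarrow> P i \<in> polys ?m" "\<And>i. i < ?m \<Longrightarrow> poly_eval ys (P i) = 0"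
    and M_det: "M = det (mat ?m ?m (\<lambda>(i, j). poly_eval ys (poly_deriv j (P i))))"
    using M unfolding jacobian_minors_def chart_relations_def by auto
  define J where "J = mat ?m ?m (\<lambda>(i, j). poly_eval ys (poly_deriv j (P i)))"
  define w where "w = vec ?m (\<lambda>j. E (ys ! j))"
  have J: "J \<in> carrier_mat ?m ?m" and w: "w \<in> carrier_vec ?m"
    by (simp_all add: J_def w_def)
  have J_in: "J $$ (i, j) \<in> adjoin ys" if "i < ?m" "j < ?m" for i j
    using that P(1) by (simp add: J_def poly_deriv_eval_in_adjoin)
  have Jw: "(J *\<^sub>v w) $ i \<in> adjoin ys" if i: "i < ?m" for i
  proof -
    have "(J *\<^sub>v w) $ i = (\<Sum>j<?m. poly_eval ys (poly_deriv j (P i)) * E (ys ! j))"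
      using i by (simp add: J_def w_def scalar_prod_def atLeast0LessThan)
    also have "\<dots> = - (\<Sum>\<alpha>\<in>Poly_Mapping.keys (P i).
        to_fract (D (Poly_Mapping.lookup (P i) \<alpha>)) * monomial_eval ys \<alpha>)"
      using derivation_poly_eval[OF E P(1)[OF i], of ys] P(2)[OF i] by (simp add: eq_neg_iff_add_eq_0 add.commute)
    finally show ?thesis
      using const[OF P(1)[OF i]] by (simp add: uminus_closed)
  qed
  have ME: "M * E (ys ! j) \<in> adjoin ys" if j: "j < ?m" for j
  proof -
    have "M * E (ys ! j) = det (replace_col J (J *\<^sub>v w) j)"
      using cramer_lemma_mat[OF J w j] j by (simp add: M_det J_def[symmetric] w_def mult.commute)
    also have "\<dots> \<in> adjoin ys"
      using J J_in Jw by (intro det_closed) (auto simp: replace_col_def)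
    finally show ?thesis .
  qed
  obtain Q where Q: "Q \<in> polys ?m" "z = poly_eval ys Q"
    using z by (auto simp: adjoin_def)
  \<comment> \<open>By the chain rule the derivatives of the generators enter linearly, so one
    factor \<open>M\<close> clears all their denominators.\<close>
  have "M * E z = M * (\<Sum>\<alpha>\<in>Poly_Mapping.keys Q. to_fract (D (Poly_Mapping.lookup Q \<alpha>)) * monomial_eval ys \<alpha>) +
      (\<Sum>j<?m. poly_eval ys (poly_deriv j Q) * (M * E (ys ! j)))"
    by (simp add: Q(2) derivation_poly_eval[OF E Q(1)] distrib_left sum_distrib_left ac_simps)
  also have "\<dots> \<in> adjoin ys"
    using mult_closed[OF jacobian_minor_in_adjoin[OF M] const[OF Q(1)]]
      mult_closed[OF poly_deriv_eval_in_adjoin[OF Q(1)] ME]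
    by (intro add_closed sum_closed) auto
  finally show ?thesis .
qed

text \<open>
  The generators are fractions \<open>a\<^sub>i / b\<^sub>i\<close>, and the relations \<open>b\<^sub>i T\<^sub>i - a\<^sub>i\<close> have a diagonal
  Jacobian matrix.
\<close>

lemma nonzero_jacobian_minor_exists: "\<exists>M\<in>jacobian_minors ys. M \<noteq> 0"
proof -
  let ?m = "length ys"
  have "\<forall>i. \<exists>a b. b \<noteq> 0 \<and> ys ! i = to_fract a / to_fract b"
    by (metis fract_as_quotient)
  then obtain a b where b: "\<And>i. b i \<noteq> 0" and y: "\<And>i. ys ! i = to_fract (a i) / to_fract (b i)"
    by metis
  define P where "P i = Poly_Mapping.single (Poly_Mapping.single i (Suc 0)) (b i) + Poly_Mapping.single 0 (- a i)" for i
  define M where "M = mat ?m ?m (\<lambda>(i, j). poly_eval ys (poly_deriv j (P i)))"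
  have "P i \<in> chart_relations ys" if "i < ?m" for i
    using that b
    by (auto simp: chart_relations_def P_def y poly_eval_add
        intro!: polys_add single_0_in_polys single_single_in_polys)
  then have "det M \<in> jacobian_minors ys"
    unfolding jacobian_minors_def M_def by auto
  moreover have "det M \<noteq> 0"
  proof -
    have entry: "poly_eval ys (poly_deriv j (P i)) = (if i = j then to_fract (b i) else 0)" for i j
    proof -
      let ?e = "Poly_Mapping.single i (Suc 0)"
      have e0: "?e \<noteq> 0"
        by (metis lookup_single_eq lookup_zero Zero_not_Suc)
      \<comment> \<open>Summing over both exponents also covers \<open>a i = 0\<close>, where the
        constant term is not among the keys.\<close>
      have "poly_eval ys (poly_deriv j (P i)) = (\<Sum>\<alpha>\<in>{?e, 0}. of_nat (Poly_Mapping.lookup \<alpha> j) *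
          to_fract (Poly_Mapping.lookup (P i) \<alpha>) * monomial_eval ys (\<alpha> - Poly_Mapping.single j 1))"
        unfolding poly_eval_poly_deriv
      proof (rule sum_keys_eq_sum_superset)
        show "Poly_Mapping.keys (P i) \<subseteq> {?e, 0}"
          unfolding P_def by (rule order.trans[OF keys_add]) auto
      qed auto
      then show ?thesis
        using e0 by (auto simp: P_def lookup_add lookup_single)
    qed
    have "det M = prod_list (diag_mat M)"
      by (rule det_upper_triangular[of _ ?m]) (auto simp: M_def entry intro!: upper_triangularI)
    then show ?thesis
      using b by (auto simp: diag_mat_def M_def entry prod_list_zero_iff)
  qed
  ultimately show ?thesis
    by blast
qed

section \<open>Log discrepancies and derivatives\<close>

lemma derivation_mfps_deriv:
  "derivation (mfps_deriv i :: ('a::comm_ring_1, 'n::finite) mfps \<Rightarrow> ('a, 'n) mfps)"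
  by unfold_locales (simp_all add: mfps_deriv_add mfps_deriv_mult)

section \<open>Discrete valuations and derivations\<close>

locale discrete_valued_field =
  fixes v :: "'k::field \<Rightarrow> int"
  assumes discrete_valuation: "discrete_valuation v"
begin

lemma v_mult: "a \<noteq> 0 \<Longrightarrow> b \<noteq> 0 \<Longrightarrow> v (a * b) = v a + v b"
  using discrete_valuation by (simp add: discrete_valuation_def)

lemma v_add: "a \<noteq> 0 \<Longrightarrow> b \<noteq> 0 \<Longrightarrow> a + b \<noteq> 0 \<Longrightarrow> min (v a) (v b) \<le> v (a + b)"
  using discrete_valuation by (simp add: discrete_valuation_def)

lemma v_1 [simp]: "v 1 = 0"
  using v_mult[of 1 1] by simp

lemma v_uminus: "a \<noteq> 0 \<Longrightarrow> v (- a) = v a"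
  using v_mult[of "- 1" "- 1"] v_mult[of "- 1" a] by simp

lemma v_power: "a \<noteq> 0 \<Longrightarrow> v (a ^ k) = int k * v a"
  by (induction k) (simp_all add: v_mult algebra_simps)

lemma v_divide: "a \<noteq> 0 \<Longrightarrow> b \<noteq> 0 \<Longrightarrow> v (a / b) = v a - v b"
  using v_mult[of "a / b" b] by simp

lemma closed_subring_valuation_ring: "closed_subring (valuation_ring v)"
proof
  show "a + b \<in> valuation_ring v" if "a \<in> valuation_ring v" "b \<in> valuation_ring v" for a b
    using that v_add[of a b] by (fastforce simp: valuation_ring_def)
  show "- a \<in> valuation_ring v" if "a \<in> valuation_ring v" for a
    using that by (cases "a = 0") (auto simp: valuation_ring_def v_uminus)
  show "a * b \<in> valuation_ring v" if "a \<in> valuation_ring v" "b \<in> valuation_ring v" for a b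
    using that by (cases "a = 0 \<or> b = 0") (auto simp: valuation_ring_def v_mult)
qed (simp add: valuation_ring_def)

text \<open>With a uniformizer \<open>t\<close> and \<open>z = t ^ k * u\<close>, the Leibniz rule
  leaves a factor \<open>t ^ (k - 1)\<close> in \<open>E z\<close>, and the cofactor is in the
  valuation ring. For \<open>k = 0\<close> it suffices that \<open>E\<close> preserves this
  ring.\<close>

lemma v_derivation_ge:
  assumes "derivation E" and E: "\<And>z. z \<in> valuation_ring v \<Longrightarrow> E z \<in> valuation_ring v"
    and z: "z \<in> valuation_ring v" "z \<noteq> 0" and Ez: "E z \<noteq> 0"
  shows "v z - 1 \<le> v (E z)"
proof -
  interpret derivation E by fact
  interpret closed_subring "valuation_ring v"
    by (rule closed_subring_valuation_ring)
  obtain t where t: "t \<noteq> 0" "v t = 1"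
    using discrete_valuation by (auto simp: discrete_valuation_def)
  obtain k where k: "v z = int k"
    using z nonneg_int_cases[of "v z"] by (auto simp: valuation_ring_def)
  show ?thesis
  proof (cases k)
    case 0
    then show ?thesis
      using E[OF z(1)] Ez k by (simp add: valuation_ring_def)
  next
    case (Suc l)
    define u where "u = z / t ^ k"
    have u: "u \<in> valuation_ring v" and z_eq: "z = t ^ k * u"
      using t z(2) by (simp_all add: u_def valuation_ring_def v_divide v_power k)
    have t_in: "t \<in> valuation_ring v"
      using t by (simp add: valuation_ring_def)
    have "E (t ^ k) = of_nat k * t ^ l * E t"
      unfolding power by (simp add: Suc)
    moreover have "t ^ k = t ^ l * t"
      by (simp add: Suc)
    ultimately have Ez_eq: "E z = t ^ l * (of_nat k * E t * u + t * E u)"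
      unfolding z_eq mult by (simp add: distrib_left ac_simps)
    have "of_nat k * E t * u + t * E u \<in> valuation_ring v"
      using u t_in by (intro add_closed mult_closed of_nat_closed E)
    then show ?thesis
      using Ez t unfolding Ez_eq k Suc by (auto simp: valuation_ring_def v_mult v_power)
  qed
qed

end

text \<open>Elements of the valuation ring are fractions \<open>a / b\<close> from the chart with
  \<open>v b = 0\<close>. The quotient rule reduces to the chart ring, and the new denominator
  \<open>b * b\<close> still has value 0.\<close>

lemma jacobian_minor_derivation_valuation_ring:
  fixes v :: "(complex, 'n::finite) mfps fract \<Rightarrow> int"
  assumes v: "discrete_valuation v" and chart: "divisor_chart v ys"
    and E: "derivation E" "\<And>a. E (to_fract a) = to_fract (D a)"
    and M: "M \<in> jacobian_minors ys" and z: "z \<in> valuation_ring v"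
  shows "M * E z \<in> valuation_ring v"
proof -
  interpret discrete_valued_field v
    by unfold_locales fact
  interpret derivation E by fact
  interpret closed_subring "adjoin ys"
    by (rule closed_subring_adjoin)
  have ring_eq: "valuation_ring v =
      {a / b | a b. a \<in> adjoin ys \<and> b \<in> adjoin ys \<and> b \<noteq> 0 \<and> v b = 0}"
    using chart by (simp add: divisor_chart_def)
  obtain a b where ab: "a \<in> adjoin ys" "b \<in> adjoin ys" "b \<noteq> 0" "v b = 0" and z_eq: "z = a / b"
    using z unfolding ring_eq by blast
  have "E a = E (z * b)"
    using ab(3) by (simp add: z_eq)
  then have "E a = E z * b + z * E b"
    by (simp add: mult)
  then have "M * E z = (b * (M * E a) - a * (M * E b)) / (b * b)"
    using ab(3) by (simp add: z_eq field_simps)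
  moreover have "b * (M * E a) - a * (M * E b) \<in> adjoin ys" "b * b \<in> adjoin ys"
    using ab(1,2) by (auto intro!: diff_closed mult_closed[of b] mult_closed[of a]
        jacobian_minor_derivation_adjoin[OF E M])
  moreover have "b * b \<noteq> 0" "v (b * b) = 0"
    using ab(3,4) by (simp_all add: v_mult)
  ultimately show ?thesis
    unfolding ring_eq by blast
qed

lemma divisorial_to_fract_in_valuation_ring:
  assumes "divisorial_at_origin v"
  shows "to_fract g \<in> valuation_ring v"
proof -
  obtain ys where chart: "divisor_chart v ys" and v: "discrete_valuation v"
    using assms by (auto simp: divisorial_at_origin_def)
  interpret discrete_valued_field v
    by unfold_locales fact
  have "to_fract g = to_fract g / 1" "(1 :: (complex, 'a) mfps fract) \<in> adjoin ys"
    using closed_subring.one_closed[OF closed_subring_adjoin] by simp_all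
  then show ?thesis
    using chart to_fract_in_adjoin[of g ys] v_1 unfolding divisor_chart_def
    by (metis (mono_tags, lifting) mem_Collect_eq one_neq_zero)
qed

text \<open>The minimum defining the log discrepancy is attained: nonzero minors exist, and they lie
  in the chart ring, so their values are nonnegative.\<close>

lemma divisorial_jacobian_minor:
  assumes "divisorial_at_origin v"
  obtains ys M where "divisor_chart v ys" "M \<in> jacobian_minors ys" "M \<noteq> 0"
    "int (log_discrepancy v) = 1 + v M"
proof -
  \<comment> \<open>This has to be the very chart chosen in \<open>log_discrepancy\<close>.\<close>
  define ys where "ys = (SOME ys. divisor_chart v ys)"
  have v: "discrete_valuation v" and "\<exists>ys. divisor_chart v ys"
    using assms by (auto simp: divisorial_at_origin_def)
  from this(2) have chart: "divisor_chart v ys"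
    unfolding ys_def by (rule someI_ex)
  interpret discrete_valued_field v
    by unfold_locales fact
  obtain M where M: "M \<in> jacobian_minors ys" "M \<noteq> 0"
    using nonzero_jacobian_minor_exists by blast
  have "1 \<in> adjoin ys"
    by (rule closed_subring.one_closed[OF closed_subring_adjoin])
  then have "M / 1 \<in> valuation_ring v"
    using chart jacobian_minor_in_adjoin[OF M(1)] v_1 unfolding divisor_chart_def
    by (metis (mono_tags, lifting) mem_Collect_eq one_neq_zero)
  then have "v M \<ge> 0"
    using M(2) by (simp add: valuation_ring_def)
  then have "\<exists>d. \<exists>M\<in>jacobian_minors ys. M \<noteq> 0 \<and> v M = int d"
    using M by (metis nonneg_int_cases)
  then have "\<exists>M\<in>jacobian_minors ys. M \<noteq> 0 \<and> v M = int (ord_relative_canonical v ys)"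
    unfolding ord_relative_canonical_def by (rule LeastI_ex)
  then show ?thesis
    using that[OF chart] by (auto simp: log_discrepancy_def ys_def)
qed

text \<open>The derivation \<open>M * E\<close> preserves the valuation ring and so lowers values by
  at most one; dividing by \<open>M\<close> costs a further \<open>v M\<close>, which makes the log
  discrepancy in total.\<close>

lemma valuation_le_deriv_plus_log_discrepancy:
  fixes g :: "(complex, 'n::finite) mfps"
  assumes v: "divisorial_at_origin v" and "mfps_deriv i g \<noteq> 0"
  shows "v (to_fract g) \<le> v (to_fract (mfps_deriv i g)) + int (log_discrepancy v)"
proof -
  interpret D: derivation "mfps_deriv i :: (complex, 'n) mfps \<Rightarrow> _"
    by (rule derivation_mfps_deriv)
  have dv: "discrete_valuation v"
    using v by (simp add: divisorial_at_origin_def)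
  interpret discrete_valued_field v
    by unfold_locales fact
  obtain ys M where M: "divisor_chart v ys" "M \<in> jacobian_minors ys" "M \<noteq> 0"
    and A: "int (log_discrepancy v) = 1 + v M"
    using v by (rule divisorial_jacobian_minor)
  obtain E where E: "derivation E" "\<And>a :: (complex, 'n) mfps. E (to_fract a) = to_fract (mfps_deriv i a)"
    using derivation_extends_to_fract[OF derivation_mfps_deriv[of i]] by metis
  interpret E: derivation E by fact
  have "derivation (\<lambda>z. M * E z)"
    by unfold_locales (simp_all add: E.add E.mult algebra_simps)
  moreover have "M * E z \<in> valuation_ring v" if "z \<in> valuation_ring v" for z
    by (rule jacobian_minor_derivation_valuation_ring[OF dv M(1) E M(2) that])
  moreover have "g \<noteq> 0"
    using assms(2) D.zero by auto
  ultimately have "v (to_fract g) - 1 \<le> v (M * E (to_fract g))"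
    using M(3) assms(2) divisorial_to_fract_in_valuation_ring[OF v]
    by (intro v_derivation_ge) (auto simp: E(2))
  then show ?thesis
    using M(3) assms(2) by (simp add: A E(2) v_mult)
qed

text \<open>Differentiating once for every variable in the monomial \<open>\<alpha>\<close>, with
  multiplicity, leads to a series with nonzero constant term, and each derivative costs at most one
  log discrepancy.\<close>

lemma valuation_le_degree_mult_log_discrepancy:
  fixes g :: "(complex, 'n::finite) mfps"
  assumes v: "divisorial_at_origin v" and "mfps_coeff g \<alpha> \<noteq> 0"
  shows "v (to_fract g) \<le> int (total_degree \<alpha>) * int (log_discrepancy v)"
  using assms(2)
proof (induction "total_degree \<alpha>" arbitrary: g \<alpha>)
  case 0
  \<comment> \<open>With nonzero constant term \<open>g\<close> is outside the maximal ideal, which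
    is the center of \<open>v\<close>, so its value is not positive.\<close>
  then have "g \<noteq> 0" "g \<notin> var_ideal"
    by (auto simp: var_ideal_eq_order_ge order_ge_def)
  then have "\<not> v (to_fract g) > 0"
    using v by (auto simp: divisorial_at_origin_def)
  then show ?case
    using 0 by simp
next
  case (Suc k)
  then have "\<alpha> \<noteq> 0"
    by auto
  then obtain i where i: "Poly_Mapping.lookup \<alpha> i > 0"
    using poly_mapping_eqI[of \<alpha> 0] by (metis gr0I lookup_zero)
  let ?\<beta> = "\<alpha> - Poly_Mapping.single i 1"
  have k: "k = total_degree ?\<beta>"
    using total_degree_minus_single[OF i] Suc.hyps(2) by simp
  \<comment> \<open>Characteristic zero: the exponent appearing as a factor is a nonzero complex
    number.\<close>
  have deriv: "mfps_coeff (mfps_deriv i g) ?\<beta> \<noteq> 0"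
    unfolding mfps_coeff_deriv minus_single_add_single[OF i]
    using Suc.prems by (simp flip: of_nat_Suc)
  then have "mfps_deriv i g \<noteq> 0"
    by auto
  then have "v (to_fract g) \<le> v (to_fract (mfps_deriv i g)) + int (log_discrepancy v)"
    by (rule valuation_le_deriv_plus_log_discrepancy[OF v])
  also have "\<dots> \<le> int k * int (log_discrepancy v) + int (log_discrepancy v)"
    using Suc.hyps(1)[OF k deriv] k by simp
  finally show ?case
    by (simp add: Suc.hyps(2)[symmetric] algebra_simps)
qed

lemma lct_ge_inverse_degree:
  fixes g :: "(complex, 'n::finite) mfps"
  assumes "g \<in> var_ideal" and "mfps_coeff g \<alpha> \<noteq> 0"
  shows "ereal (1 / real (total_degree \<alpha>)) \<le> lct g"
  unfolding lct_def
proof (rule INF_greatest)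
  fix v :: "(complex, 'n) mfps fract \<Rightarrow> int"
  assume "v \<in> {v. divisorial_at_origin v}"
  then have v: "divisorial_at_origin v"
    by simp
  have "g \<noteq> 0"
    using assms(2) by auto
  then have pos: "v (to_fract g) > 0"
    using v assms(1) unfolding divisorial_at_origin_def by blast
  have le: "v (to_fract g) \<le> int (total_degree \<alpha>) * int (log_discrepancy v)"
    using v assms(2) by (rule valuation_le_degree_mult_log_discrepancy)
  then have "total_degree \<alpha> > 0"
    using pos by (cases "total_degree \<alpha>") auto
  moreover have "real_of_int (v (to_fract g)) \<le> real (total_degree \<alpha>) * real (log_discrepancy v)"
    using le by (metis of_int_le_iff of_int_mult of_int_of_nat_eq)
  ultimately show "ereal (1 / real (total_degree \<alpha>)) \<le>
      ereal (real (log_discrepancy v) / real_of_int (v (to_fract g)))"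
    using pos by (simp add: field_simps)
qed

section \<open>Comparison of the invariants\<close>

lemma quotient_dim_eq_enatD:
  assumes "quotient_dim I = enat k"
  obtains B where "quotient_basis I B" "card B = k"
  using assms unfolding quotient_dim_def by (metis enat.distinct(1) enat.inject someI_ex)

lemma to_complex_mfps_order_ge: "f \<in> order_ge k \<Longrightarrow> to_complex_mfps f \<in> order_ge k"
  by (simp add: order_ge_def to_complex_mfps_def)

text \<open>An empty basis would put 1 into the ideal. This makes the Milnor and Tjurina numbers
  positive, so that their reciprocals can be handled as real numbers.\<close>

lemma quotient_basis_nonempty:
  assumes "quotient_basis I B" "I \<subseteq> order_ge 1"
  shows "card B > 0"
proof (rule ccontr)
  assume "\<not> card B > 0"
  then have "B = {}"
    using assms(1) by (simp add: quotient_basis_def)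
  then have "1 \<in> I"
    using assms(1) by (auto simp: quotient_basis_def)
  then show False
    using assms(2) order_geD[of 1 1 0] by (auto simp: mfps_coeff_1)
qed

lemma Jac_subset_order_ge:
  assumes "f \<in> order_ge (Suc k)"
  shows "Jac f \<subseteq> order_ge k"
  unfolding Jac_def using assms by (intro ideal_of_subset_order_ge) (auto intro: order_ge_deriv)

section \<open>The order and the exponent of an isolated singularity\<close>

locale isolated_singularity =
  fixes f :: "(complex, 'n::finite) mfps" and B
  assumes order2: "f \<in> order_ge 2" and milnor_basis: "quotient_basis (Jac f) B"
begin

sublocale mfps_quotient "range (\<lambda>i. mfps_deriv i f)" B
  by unfold_locales (use milnor_basis in \<open>simp add: Jac_def\<close>)

lemma card_basis_pos: "card B > 0"
  using milnor_basis Jac_subset_order_ge[of f 1] order2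
  by (intro quotient_basis_nonempty[of "Jac f"]) (simp_all add: numeral_2_eq_2)

lemma in_order_ge_1: "f \<in> order_ge 1"
  using order2 by (simp add: order_ge_def)

text \<open>The minimum exists because \<open>f ^ card B\<close> has order at least
  \<open>card B\<close> and therefore lies in \<open>Jac f\<close>.\<close>

lemma bs_exponent: "bs_exponent f \<ge> 1" "f ^ bs_exponent f \<in> Jac f"
proof -
  have "f ^ card B \<in> order_ge (card B)"
    using order_ge_power[OF in_order_ge_1, of "card B"] by simp
  then have "f ^ card B \<in> Jac f"
    using order_ge_card_basis_subset by (auto simp: Jac_def)
  then have "\<exists>N. N \<ge> 1 \<and> f ^ N \<in> Jac f"
    using card_basis_pos by (intro exI[of _ "card B"]) simp
  then have "bs_exponent f \<ge> 1 \<and> f ^ bs_exponent f \<in> Jac f"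
    unfolding bs_exponent_def by (rule LeastI_ex)
  then show "bs_exponent f \<ge> 1" "f ^ bs_exponent f \<in> Jac f"
    by auto
qed

lemma order_mult_bs_exponent_less:
  assumes "f \<in> order_ge d"
  shows "(bs_exponent f - 1) * d < card B"
\<comment> \<open>For exponent 1 minimality says nothing about \<open>f ^ 0\<close>, but then the
  claim is only that \<open>card B\<close> is positive.\<close>
proof (cases "bs_exponent f = 1")
  case False
  let ?N = "bs_exponent f - 1"
  have "?N \<ge> 1" "?N < bs_exponent f"
    using False bs_exponent(1) by auto
  then have notin: "f ^ ?N \<notin> Jac f"
    unfolding bs_exponent_def using not_less_Least by blast
  show ?thesis
  proof (rule ccontr)
    assume "\<not> ?N * d < card B"
    then have "f ^ ?N \<in> order_ge (card B)"
      using order_ge_power[OF assms, of ?N] by (auto simp: order_ge_def)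
    then show False
      using notin order_ge_card_basis_subset by (auto simp: Jac_def)
  qed
qed (use card_basis_pos in simp)

text \<open>The point is that \<open>f\<close> is nonzero: otherwise \<open>Jac f\<close> would
  contain only series of order above \<open>card B\<close>, whereas it contains the power
  \<open>card B\<close> of any variable.\<close>

lemma order_exists:
  obtains d \<alpha> where "f \<in> order_ge d" "total_degree \<alpha> = d" "mfps_coeff f \<alpha> \<noteq> 0"
proof -
  have "f \<noteq> 0"
  proof
    assume "f = 0"
    then have "Jac f \<subseteq> order_ge (Suc (card B))"
      by (intro Jac_subset_order_ge) simp
    \<comment> \<open>\<open>undefined\<close> is just some variable; the index type is
      inhabited.\<close>
    moreover let ?h = "mfps_X undefined ^ card B :: (complex, 'n) mfps"
    have "?h \<in> order_ge (card B)"
      using order_ge_power[OF X_in_order_ge, of undefined "card B"] by simp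
    then have "?h \<in> Jac f"
      using order_ge_card_basis_subset by (auto simp: Jac_def)
    moreover have "mfps_coeff (mfps_X i ^ k :: (complex, 'n) mfps) (Poly_Mapping.single i k) = 1" for i k
      by (induction k) (simp_all add: mfps_coeff_1 mfps_coeff_X_mult flip: single_diff)
    ultimately show False
      using order_geD[of ?h "Suc (card B)" "Poly_Mapping.single undefined (card B)"] by auto
  qed
  then have "\<exists>k. \<exists>\<alpha>. total_degree \<alpha> = k \<and> mfps_coeff f \<alpha> \<noteq> 0"
    by (metis mfps_coeff_0 mfps_eqI)
  then obtain d where d: "\<exists>\<alpha>. total_degree \<alpha> = d \<and> mfps_coeff f \<alpha> \<noteq> 0"
    and least: "\<And>k. k < d \<Longrightarrow> \<not> (\<exists>\<alpha>. total_degree \<alpha> = k \<and> mfps_coeff f \<alpha> \<noteq> 0)"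
    using exists_least_iff[of "\<lambda>k. \<exists>\<alpha>. total_degree \<alpha> = k \<and> mfps_coeff f \<alpha> \<noteq> 0"] by blast
  from least have "f \<in> order_ge d"
    by (auto simp: order_ge_def)
  then show ?thesis
    using d that by blast
qed

end

theorem corollary1p3:
  fixes f :: "(int, 'n::finite) mfps"
  assumes "f \<in> ideal_prod var_ideal var_ideal"
    and "milnor (to_complex_mfps f) < \<infinity>"
  shows "lct (to_complex_mfps f) \<ge>
           1 / ereal_of_enat (tjurina (to_complex_mfps f))
         - 1 / ereal_of_enat (milnor (to_complex_mfps f))
       \<and> lct (to_complex_mfps f) * ereal_of_enat (milnor (to_complex_mfps f)) + 1 \<ge>
           ereal (real (bs_exponent (to_complex_mfps f)))"
proof -
  let ?f = "to_complex_mfps f"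
  obtain \<mu> where \<mu>: "milnor ?f = enat \<mu>"
    using assms(2) by (cases "milnor ?f") auto
  then obtain B where B: "quotient_basis (Jac ?f) B" "card B = \<mu>"
    unfolding milnor_def by (rule quotient_dim_eq_enatD)
  have order2: "?f \<in> order_ge 2"
    using assms(1) ideal_prod_var_ideal_subset by (auto intro: to_complex_mfps_order_ge)
  interpret isolated_singularity ?f B
    using order2 B(1) by unfold_locales
  let ?e = "bs_exponent ?f"
  obtain d \<alpha> where d: "?f \<in> order_ge d" "total_degree \<alpha> = d" "mfps_coeff ?f \<alpha> \<noteq> 0"
    by (rule order_exists)
  have d_pos: "d > 0"
    using d(2,3) order_geD[OF in_order_ge_1, of \<alpha>] by auto
  have lct: "ereal (1 / real d) \<le> lct ?f"
    using lct_ge_inverse_degree[OF _ d(3)] in_order_ge_1 by (simp add: d(2) var_ideal_eq_order_ge)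
  have \<mu>_pos: "\<mu> > 0"
    using card_basis_pos B(2) by simp
  have "real ((?e - 1) * d) < real \<mu>"
    using order_mult_bs_exponent_less[OF d(1)] unfolding B(2) of_nat_less_iff .
  then have ed: "real ?e - 1 < real \<mu> / real d"
    using d_pos bs_exponent(1) by (simp add: of_nat_diff field_simps)
  have "ereal (real ?e) \<le> ereal (1 / real d) * ereal (real \<mu>) + 1"
    using ed by (simp add: one_ereal_def)
  also have "\<dots> \<le> lct ?f * ereal_of_enat (milnor ?f) + 1"
    unfolding \<mu> ereal_of_enat_simps using lct
    by (intro add_right_mono ereal_mult_right_mono) simp_all
  finally have part2: "ereal (real ?e) \<le> lct ?f * ereal_of_enat (milnor ?f) + 1" .
  \<comment> \<open>Like the second inequality, the first one is obtained by passing through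
    \<open>1 / d\<close>.\<close>
  have "1 / ereal_of_enat (tjurina ?f) - 1 / ereal_of_enat (milnor ?f) \<le> ereal (1 / real d)"
  proof (cases "tjurina ?f")
    case (enat \<tau>)
    then obtain B' where B': "quotient_basis (ideal_of (Jac ?f \<union> {?f})) B'" "card B' = \<tau>"
      unfolding tjurina_def by (rule quotient_dim_eq_enatD)
    have "ideal_of (Jac ?f \<union> {?f}) \<subseteq> order_ge 1"
      using Jac_subset_order_ge[of ?f 1] order2 in_order_ge_1
      by (intro ideal_of_subset_order_ge) (auto simp: numeral_2_eq_2)
    then have \<tau>_pos: "\<tau> > 0"
      using quotient_basis_nonempty[OF B'(1)] B'(2) by simp
    have "\<mu> \<le> ?e * \<tau>"
      using card_basis_le[of ?f B' ?e] B' bs_exponent(2) B(2) by (simp add: Jac_def)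
    then have "real \<mu> \<le> real ?e * real \<tau>"
      by (metis of_nat_le_iff of_nat_mult)
    then have "1 / real \<tau> \<le> real ?e / real \<mu>"
      using \<tau>_pos \<mu>_pos by (simp add: field_simps)
    \<comment> \<open>Subtracting \<open>1 / \<mu>\<close> from \<open>?e / \<mu>\<close> gives
      exactly the quantity bounded through the order of \<open>f\<close>.\<close>
    moreover have "(real ?e - 1) / real \<mu> \<le> 1 / real d"
      using ed \<mu>_pos d_pos by (simp add: field_simps)
    ultimately have "1 / real \<tau> - 1 / real \<mu> \<le> 1 / real d"
      by (simp add: diff_divide_distrib)
    then show ?thesis
      using \<tau>_pos \<mu>_pos by (simp add: \<mu> enat one_ereal_def)
  next
    case infinity
    \<comment> \<open>Since \<open>1 / \<infinity> = 0\<close> in the extended reals, the left-hand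
      side is \<open>- (1 / \<mu>)\<close> here.\<close>
    have "- (1 / real \<mu>) \<le> 0" "0 \<le> 1 / real d"
      by simp_all
    then have "- (1 / real \<mu>) \<le> 1 / real d"
      by linarith
    then show ?thesis
      using infinity \<mu>_pos by (simp add: \<mu> one_ereal_def)
  qed
  then show ?thesis
    using lct part2 by (auto intro: order.trans)
qed

end
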